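(* Let $N\ge1$, $\omega_1,\dots,\omega_N\in\mathbb{R}$, $\kappa\in\mathbb{R}$, $(\theta_i^0)\in\mathbb{R}^N$, and let $\Theta(t)=(\theta_i(t))$ solve \[ \dot\theta_i=\omega_i-\frac{\kappa}{N}\sum_{j=1}^N(1+\cos\theta_j)\sin\theta_i,\qquad\theta_i(0)=\theta_i^0, \] with $R(t)=\frac1N\sum_j(1+\cos\theta_j(t))$ and $R_0=R(0)$. Let $\|\Omega\|_\infty=\max_i|\omega_i|$. Suppose $R_0>0$, fix $\mu\in(0,\min\{R_0,1\})$ and suppose \[ \kappa>\frac{\|\Omega\|_\infty}{(R_0-\mu)\sqrt{\mu(2-\mu)}}. \] Set $\tau=\frac{\pi}{\kappa(R_0-\mu)\sqrt{\mu(2-\mu)}-\|\Omega\|_\infty}$ and $\lambda=\kappa(R_0-\mu)(1-\mu)$. Then: (a) $R(t)\ge R_0-\mu$ for all $t\ge0$; (b) for all $i$, $\lim_{t\to\infty}\theta_i(t)$ exists, $\sup_{t\ge0}\theta_i(t)-\inf_{t\ge0}\theta_i(t)<2\pi$ and $\lim_{t\to\infty}\dot\theta_i(t)=0$; (c) for any $i$ and $t_0\ge0$ with $\cos\theta_i(t_0)\ge-1+\mu$, we have $\cos\theta_i(t)\ge-1+\mu$ for $t\ge t_0$ and $\cos\theta_i(t)\ge1-\mu$ for $t\ge t_0+\tau$; (d) for any $i$, either $\sup_{t\ge0}\cos\theta_i(t)<-1+\mu$, in which case $\lim_{t\to\infty}\theta_i(t)=\pi-\sin^{-1}\frac{\omega_i}{\kappa\lim_{t\to\infty}R(t)}\pmod{2\pi}$,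 or $\sup_{t\ge0}\cos\theta_i(t)\ge-1+\mu$, in which case $\lim_{t\to\infty}\theta_i(t)=\sin^{-1}\frac{\omega_i}{\kappa\lim_{t\to\infty}R(t)}\pmod{2\pi}$; (e) for fixed $i,j$, suppose there is $t_0\ge0$ with $\cos\theta_i(t_0)\ge-1+\mu$ and $\cos\theta_j(t_0)\ge-1+\mu$. If $\omega_i>\omega_j$, then after translations by multiples of $2\pi$, \[ \theta_i(t)-\theta_j(t)\le\frac{\omega_i-\omega_j}{\lambda}+\pi e^{-\lambda(t-t_0-\tau)}\quad\text{for }t\ge t_0+\tau, \] \[ \theta_i(t)-\theta_j(t)\ge\frac{\omega_i-\omega_j}{2\kappa}-\frac{\omega_i-\omega_j}{2\kappa}e^{-2\kappa\left(t-t_0-\tau-\frac{\pi}{\omega_i-\omega_j}\right)}\quad\text{for }t\ge t_0+\tau+\frac{\pi}{\omega_i-\omega_j}; \] if $\omega_i=\omega_j$, then after translations by multiples of $2\pi$, $|\theta_i(t)-\theta_j(t)|\le\pi e^{-\lambda(t-t_0-\tau)}$ for $t\ge t_0+\tau$ (so $\theta_i-\theta_j\to0$). *)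

theory Defs
  imports Complex_Main
begin

text \<open>Oscillators are indexed by 0..N-1 (paper: 1..N). A trajectory is
  theta :: real => nat => real, theta t i being the i-th phase at time t.\<close>

definition orderR :: "nat \<Rightarrow> (real \<Rightarrow> nat \<Rightarrow> real) \<Rightarrow> real \<Rightarrow> real" where
  "orderR N \<theta> t = (1 / real N) * (\<Sum>j<N. 1 + cos (\<theta> t j))"

definition normInf :: "nat \<Rightarrow> (nat \<Rightarrow> real) \<Rightarrow> real" where
  "normInf N \<omega> = Max ((\<lambda>i. \<bar>\<omega> i\<bar>) ` {..<N})"

definition vel :: "nat \<Rightarrow> (nat \<Rightarrow> real) \<Rightarrow> real \<Rightarrow> (real \<Rightarrow> nat \<Rightarrow> real) \<Rightarrow> nat \<Rightarrow> real \<Rightarrow> real" where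
  "vel N \<omega> \<kappa> \<theta> i t = \<omega> i - \<kappa> / real N * (\<Sum>j<N. 1 + cos (\<theta> t j)) * sin (\<theta> t i)"

end

theory Submission
  imports Defs "HOL-Complex_Analysis.Complex_Analysis" "HOL-Real_Asymp.Real_Asymp"
begin

text \<open>
  While $R$ stays near its initial value, $\cos\theta_i$ increases on the strip
  $|\cos\theta_i| \le 1 - \mu$, so no oscillator can lose more than $\mu$ of its contribution to $R$;
  as the hypothesis on $\kappa$ is strict, this closes a bootstrap and gives (a), and then (c).
  Since an oscillator that has entered the strip never falls back, phases are bounded; the system is
  a gradient flow, so all velocities tend to $0$ by Barbalat's argument.  Every accumulation
  point $r$ of $R$ then satisfies $r = \frac1N \sum_i (1 + \sigma_i \sqrt{1 - (\omega_i / \kappa r)^2})$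
  with signs $\sigma_i$ fixed by the dichotomy in (d).  The solutions of this analytic equation
  contain no interval, so $R$ converges, which replaces the appeal to the {\L}ojasiewicz inequality;
  the phases follow.  Part (e) is a scalar comparison for $\theta_i - \theta_j$.
\<close>

section \<open>Differential inequalities on an interval\<close>

text \<open>The strip enters through one number: on |cos x| \<le> 1 - \<mu> one has |sin x| \<ge>
  sqrt (\<mu> (2 - \<mu>)). As long as R \<ge> r and \<kappa> r sqrt (\<mu> (2 - \<mu>)) exceeds
  every |\<omega>_i|, the coupling beats each natural frequency there and drives the phase towards
  cos = 1. The strict hypothesis leaves room for an r slightly below R(0) - \<mu>. The obstacle is
  that vanishing velocities alone do not make phases converge: R could drift ever more slowly along
  a continuum of equilibria. A bounded continuous R without a limit takes all values of some
  interval at arbitrarily late times, and each such value would solve the limiting equation.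
  Persistence in the strip makes the signs in that equation constants instead of functions of time,
  and |\<omega>_i| / \<kappa> \<le> R(0) - \<mu> keeps its square roots away from their branch cut,
  so that it is analytic on the range where R lives.\<close>

lemma last_crossing:
  fixes f :: "real \<Rightarrow> real"
  assumes "a \<le> b" and cont: "continuous_on {a..b} f" and fa: "f a \<ge> c" and fb: "f b < c"
  shows "\<exists>s. a \<le> s \<and> s < b \<and> f s = c \<and> (\<forall>x. s < x \<and> x \<le> b \<longrightarrow> f x < c)"
proof -
  \<comment> \<open>The crossing time is the maximum of this compact set. A value above
    \<open>c\<close> there would, by intermediate values, produce a later point of the set.\<close>
  let ?S = "{x \<in> {a..b}. c \<le> f x}"
  have "closed ?S"
    using continuous_closed_preimage[OF cont closed_atLeastAtMost closed_atLeast[of c]]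
    by (simp add: vimage_def Int_def)
  moreover have "bounded ?S" by (rule bounded_subset[of "{a..b}"]) auto
  ultimately have "compact ?S" by (simp add: compact_eq_bounded_closed)
  moreover have "a \<in> ?S" using fa \<open>a \<le> b\<close> by auto
  then have "?S \<noteq> {}" by blast
  ultimately obtain s where s: "s \<in> ?S" "\<And>x. x \<in> ?S \<Longrightarrow> x \<le> s"
    using compact_attains_sup[of ?S] by (auto simp del: mem_Collect_eq)
  have after: "f x < c" if "s < x" "x \<le> b" for x
    using s(2)[of x] s(1) that by (cases "f x < c") auto
  have "s \<noteq> b" using s(1) fb by auto
  then have "s < b" using s(1) by auto
  moreover have "f s = c"
  proof (rule ccontr)
    assume "f s \<noteq> c"
    then have "f s > c" using s(1) by auto
    have "continuous_on {s..b} f"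
      by (rule continuous_on_subset[OF cont]) (use s(1) in auto)
    then obtain x where "s \<le> x" "x \<le> b" "f x = c"
      using IVT2'[of f b c s] fb \<open>f s > c\<close> \<open>s < b\<close> by auto
    then show False using after[of x] \<open>f s > c\<close> by (cases "x = s") auto
  qed
  ultimately show ?thesis using after s(1) by (intro exI[of _ s]) auto
qed

text \<open>Just after the last time on the level \<open>c\<close>, a positive derivative would lift
  \<open>f\<close> above \<open>c\<close> again. The sign condition concerns the level alone, so it
  can be checked at any single level of \<open>cos\<close> inside the strip.\<close>

lemma strict_barrier:
  fixes f :: "real \<Rightarrow> real"
  assumes "a \<le> b"
    and der: "\<And>t. a \<le> t \<Longrightarrow> t \<le> b \<Longrightarrow> (f has_real_derivative f' t) (at t within {a..b})"
    and fa: "f a \<ge> c"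
    and pos: "\<And>t. a \<le> t \<Longrightarrow> t \<le> b \<Longrightarrow> f t = c \<Longrightarrow> f' t > 0"
  shows "f b \<ge> c"
proof (rule ccontr)
  assume "\<not> f b \<ge> c"
  then have fb: "f b < c" by simp
  have cont: "continuous_on {a..b} f"
    using der by (intro DERIV_continuous_on) auto
  obtain s where s: "a \<le> s" "s < b" "f s = c" "\<And>x. s < x \<Longrightarrow> x \<le> b \<Longrightarrow> f x < c"
    using last_crossing[OF \<open>a \<le> b\<close> cont fa fb] by blast
  obtain d where d: "d > 0" "\<And>h. h > 0 \<Longrightarrow> s + h \<in> {a..b} \<Longrightarrow> h < d \<Longrightarrow> f s < f (s + h)"
    using has_real_derivative_pos_inc_right[OF der[of s] pos[of s]] s(1-3) by auto
  define h where "h = min (d / 2) (b - s)"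
  have "f s < f (s + h)" by (rule d(2)) (use d(1) s(1-3) in \<open>auto simp: h_def min_def\<close>)
  moreover have "f (s + h) < c" by (rule s(4)) (use d(1) s(1-3) in \<open>auto simp: h_def\<close>)
  ultimately show False using s by simp
qed

text \<open>After its last time on the level \<open>c\<close> the function would stay below
  \<open>c\<close>, exactly where it is nondecreasing. Asking for the sign only below
  \<open>c\<close> suits differential inequalities that hold for one sign of the unknown.\<close>

lemma weak_barrier:
  fixes f :: "real \<Rightarrow> real"
  assumes "a \<le> b"
    and der: "\<And>t. a \<le> t \<Longrightarrow> t \<le> b \<Longrightarrow> (f has_real_derivative f' t) (at t within {a..b})"
    and fa: "f a \<ge> c"
    and nonneg: "\<And>t. a \<le> t \<Longrightarrow> t \<le> b \<Longrightarrow> f t < c \<Longrightarrow> f' t \<ge> 0"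
  shows "f b \<ge> c"
proof (rule ccontr)
  assume "\<not> f b \<ge> c"
  then have fb: "f b < c" by simp
  have cont: "continuous_on {a..b} f"
    using der by (intro DERIV_continuous_on) auto
  obtain s where s: "a \<le> s" "s < b" "f s = c" "\<And>x. s < x \<Longrightarrow> x \<le> b \<Longrightarrow> f x < c"
    using last_crossing[OF \<open>a \<le> b\<close> cont fa fb] by blast
  have "f s \<le> f b"
  proof (rule DERIV_nonneg_imp_increasing_open[of s b f])
    fix x assume x: "s < x" "x < b"
    then have "(f has_real_derivative f' x) (at x)"
      using der[of x] s(1) at_within_Icc_at[of a x b] by auto
    then show "\<exists>y. (f has_real_derivative y) (at x) \<and> 0 \<le> y"
      using nonneg[of x] s(1) s(4)[of x] x by auto
  qed (use s(1,2) in \<open>auto intro: continuous_on_subset[OF cont]\<close>)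
  then show False using s(3) fb by simp
qed

lemma deriv_lower_bound_imp_growth:
  fixes f :: "real \<Rightarrow> real"
  assumes "a \<le> b"
    and der: "\<And>t. a \<le> t \<Longrightarrow> t \<le> b \<Longrightarrow> (f has_real_derivative f' t) (at t within {a..b})"
    and ge: "\<And>t. a \<le> t \<Longrightarrow> t \<le> b \<Longrightarrow> c \<le> f' t"
  shows "c * (b - a) \<le> f b - f a"
proof -
  have "f b - c * (b - a) \<ge> f a"
    by (rule weak_barrier[of a b "\<lambda>x. f x - c * (x - a)" "\<lambda>x. f' x - c"])
      (use assms in \<open>auto intro!: derivative_eq_intros\<close>)
  then show ?thesis by simp
qed

text \<open>Integrating factor: the barrier is applied to the negative of
  \<open>D - \<Delta> / lam\<close> times an exponential. The inequality \<open>le\<close> is asked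
  only where \<open>D s \<ge> 0\<close>, because a value beyond the barrier already forces
  \<open>D s > \<Delta> / lam \<ge> 0\<close>.\<close>

lemma linear_comparison_upper:
  fixes D :: "real \<Rightarrow> real"
  assumes "T \<le> t" "lam > 0" "\<Delta> \<ge> 0" "D T \<le> C" "C \<ge> 0"
    and der: "\<And>s. T \<le> s \<Longrightarrow> s \<le> t \<Longrightarrow> (D has_real_derivative D' s) (at s within {T..t})"
    and le: "\<And>s. T \<le> s \<Longrightarrow> s \<le> t \<Longrightarrow> D s \<ge> 0 \<Longrightarrow> D' s \<le> \<Delta> - lam * D s"
  shows "D t \<le> \<Delta> / lam + C * exp (- lam * (t - T))"
proof -
  let ?f = "\<lambda>s. - (D s - \<Delta> / lam) * exp (lam * (s - T))"
  have "?f t \<ge> - C"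
  proof (rule weak_barrier[OF \<open>T \<le> t\<close>])
    fix s assume s: "T \<le> s" "s \<le> t"
    show "(?f has_real_derivative - (D' s + lam * D s - \<Delta>) * exp (lam * (s - T))) (at s within {T..t})"
      by (rule derivative_eq_intros der[OF s] refl | simp)+
        (use \<open>lam > 0\<close> in \<open>simp add: field_simps\<close>)
    assume "?f s < - C"
    then have "0 < (D s - \<Delta> / lam) * exp (lam * (s - T))"
      unfolding mult_minus_left using \<open>C \<ge> 0\<close> by linarith
    then have "D s > \<Delta> / lam" by (simp add: zero_less_mult_iff)
    moreover have "\<Delta> / lam \<ge> 0" using assms by simp
    ultimately have "D s \<ge> 0" by linarith
    then have "D' s + lam * D s - \<Delta> \<le> 0" using le[OF s] by simp
    then show "0 \<le> - (D' s + lam * D s - \<Delta>) * exp (lam * (s - T))"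
      by (intro mult_nonneg_nonneg) auto
  next
    have "\<Delta> / lam \<ge> 0" using assms by simp
    then show "- C \<le> - (D T - \<Delta> / lam) * exp (lam * (T - T))" using assms(4) by simp
  qed
  then have "(D t - \<Delta> / lam) * exp (lam * (t - T)) \<le> C"
    unfolding mult_minus_left by linarith
  then have "D t - \<Delta> / lam \<le> C / exp (lam * (t - T))" by (simp add: pos_le_divide_eq)
  then have "D t - \<Delta> / lam \<le> C * exp (- (lam * (t - T)))"
    unfolding exp_minus divide_inverse[of _ "exp _"] .
  then show ?thesis unfolding mult_minus_left by linarith
qed

lemma linear_comparison_lower:
  fixes D :: "real \<Rightarrow> real"
  assumes "T \<le> t" "K > 0" "D T \<ge> 0"
    and der: "\<And>s. T \<le> s \<Longrightarrow> s \<le> t \<Longrightarrow> (D has_real_derivative D' s) (at s within {T..t})"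
    and ge: "\<And>s. T \<le> s \<Longrightarrow> s \<le> t \<Longrightarrow> \<Delta> - K * D s \<le> D' s"
  shows "\<Delta> / K - \<Delta> / K * exp (- K * (t - T)) \<le> D t"
proof -
  let ?f = "\<lambda>s. (D s - \<Delta> / K) * exp (K * (s - T))"
  have "?f t \<ge> - (\<Delta> / K)"
  proof (rule weak_barrier[OF \<open>T \<le> t\<close>])
    fix s assume s: "T \<le> s" "s \<le> t"
    show "(?f has_real_derivative (D' s + K * D s - \<Delta>) * exp (K * (s - T))) (at s within {T..t})"
      by (rule derivative_eq_intros der[OF s] refl | simp)+
        (use \<open>K > 0\<close> in \<open>simp add: field_simps\<close>)
    show "0 \<le> (D' s + K * D s - \<Delta>) * exp (K * (s - T))" using ge[OF s] by simp
  qed (use assms in simp)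
  then have "- (\<Delta> / K) / exp (K * (t - T)) \<le> D t - \<Delta> / K" by (simp only: pos_divide_le_eq exp_gt_zero)
  then have "- (\<Delta> / K) * exp (- (K * (t - T))) \<le> D t - \<Delta> / K"
    unfolding exp_minus divide_inverse[of _ "exp _"] .
  then show ?thesis unfolding mult_minus_left by linarith
qed

text \<open>While \<open>D\<close> is nonpositive it climbs at rate at least
  \<open>\<Delta>\<close>, so a deficit of at most \<open>C\<close> is made up within time
  \<open>C / \<Delta>\<close>. At the value 0 the derivative is positive, so \<open>D\<close> cannot
  fall back.\<close>

lemma nonneg_after_growth:
  fixes D :: "real \<Rightarrow> real"
  assumes "\<Delta> > 0" "C \<ge> 0" "D T \<ge> - C" and t: "t \<ge> T + C / \<Delta>"
    and der: "\<And>s a b. T \<le> a \<Longrightarrow> a \<le> s \<Longrightarrow> (D has_real_derivative D' s) (at s within {a..b})"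
    and ge: "\<And>s. T \<le> s \<Longrightarrow> D s \<le> 0 \<Longrightarrow> \<Delta> \<le> D' s"
  shows "D t \<ge> 0"
proof (rule ccontr)
  assume neg: "\<not> D t \<ge> 0"
  have "C / \<Delta> \<ge> 0" using assms by simp
  then have "T \<le> t" using t by linarith
  have D_neg: "D s < 0" if s: "T \<le> s" "s \<le> t" for s
  proof (rule ccontr)
    assume "\<not> D s < 0"
    have "D t \<ge> 0"
    proof (rule strict_barrier[OF s(2) der])
      show "D' x > 0" if "s \<le> x" "D x = 0" for x
        using ge[of x] that s \<open>\<Delta> > 0\<close> by auto
    qed (use \<open>\<not> D s < 0\<close> s in auto)
    then show False using neg by simp
  qed
  have "\<Delta> * (t - T) \<le> D t - D T"
    by (rule deriv_lower_bound_imp_growth[OF \<open>T \<le> t\<close>, of D D']) (use der ge less_imp_le[OF D_neg] in auto)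
  moreover have "C \<le> \<Delta> * (t - T)" using t \<open>\<Delta> > 0\<close> by (simp add: field_simps)
  ultimately show False using neg assms(3) by linarith
qed

text \<open>Since \<open>g\<close> falls at rate at most \<open>K\<close>, a value of at least
  \<open>e\<close> keeps \<open>g\<close> above \<open>e / 2\<close> for a time
  \<open>e / (2 * K)\<close>. This raises \<open>E\<close> by a fixed amount, which is impossible
  once the monotone \<open>E\<close> is closer than that to its supremum.\<close>

lemma barbalat:
  fixes E g :: "real \<Rightarrow> real"
  assumes der: "\<And>t. t \<ge> 0 \<Longrightarrow> (E has_real_derivative g t) (at t within {0..})"
    and bdd: "\<And>t. t \<ge> 0 \<Longrightarrow> E t \<le> B"
    and nonneg: "\<And>t. t \<ge> 0 \<Longrightarrow> g t \<ge> 0"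
    and K: "K > 0" and lip: "\<And>s t. 0 \<le> s \<Longrightarrow> s \<le> t \<Longrightarrow> g s - g t \<le> K * (t - s)"
  shows "(g \<longlongrightarrow> 0) at_top"
proof -
  have grow: "c * (t - s) \<le> E t - E s"
    if "0 \<le> s" "s \<le> t" and gc: "\<And>x. s \<le> x \<Longrightarrow> x \<le> t \<Longrightarrow> g x \<ge> c" for s t c
    by (rule deriv_lower_bound_imp_growth[OF \<open>s \<le> t\<close> DERIV_subset[OF der] gc]) (use that in auto)
  have mono: "E s \<le> E t" if "0 \<le> s" "s \<le> t" for s t
    using grow[of s t 0] that nonneg by auto
  define M where "M = (SUP t\<in>{0..}. E t)"
  have bd: "bdd_above (E ` {0..})" using bdd by (auto intro!: bdd_aboveI[of _ B])
  have "\<forall>\<^sub>F t in at_top. g t < e" if "e > 0" for e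
  proof -
    define h where "h = e / (2 * K)"
    have "h > 0" using K that by (simp add: h_def)
    have "M - e / 2 * h < M" using that \<open>h > 0\<close> by simp
    then obtain s where s: "s \<ge> 0" "E s > M - e / 2 * h"
      unfolding M_def using less_cSUP_iff[OF _ bd] by auto
    have "g t < e" if "t \<ge> s" for t
    proof (rule ccontr)
      assume ge: "\<not> g t < e"
      have "e / 2 * ((t + h) - t) \<le> E (t + h) - E t"
      proof (rule grow)
        fix x assume x: "t \<le> x" "x \<le> t + h"
        have "g t - g x \<le> K * (x - t)" using lip x s that by auto
        also have "\<dots> \<le> K * h" using x K by auto
        also have "\<dots> = e / 2" using K by (simp add: h_def)
        finally show "e / 2 \<le> g x" using ge by simp
      qed (use s that \<open>h > 0\<close> in auto)
      moreover have "E (t + h) \<le> M" unfolding M_def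
        by (rule cSUP_upper[OF _ bd]) (use s that \<open>h > 0\<close> in auto)
      ultimately show False using s mono[of s t] that by simp
    qed
    then show ?thesis unfolding eventually_at_top_linorder by blast
  qed
  moreover have "\<forall>\<^sub>F t in at_top. g t > e" if "e < 0" for e
    unfolding eventually_at_top_linorder using nonneg that by (intro exI[of _ 0]) force
  ultimately show ?thesis by (intro order_tendstoI) auto
qed

section \<open>Limits at infinity and phases\<close>

text \<open>By intermediate values, a level avoided at all late times leaves \<open>R\<close>
  eventually on one side of it. The limit is the supremum of the levels eventually exceeded: avoided
  levels lie arbitrarily close above it, and \<open>R\<close> must end up below each of
  them.\<close>

lemma tendsto_at_top_if_avoids_dense:
  fixes R :: "real \<Rightarrow> real"
  assumes cont: "continuous_on {0..} R"
    and bds: "\<And>t. t \<ge> 0 \<Longrightarrow> p \<le> R t" "\<And>t. t \<ge> 0 \<Longrightarrow> R t \<le> q"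
    and dense: "\<And>a b. p \<le> a \<Longrightarrow> a < b \<Longrightarrow> \<exists>r. a < r \<and> r < b \<and> (\<forall>\<^sub>F t in at_top. R t \<noteq> r)"
  shows "\<exists>L. (R \<longlongrightarrow> L) at_top"
proof -
  have side: "(\<forall>\<^sub>F t in at_top. R t > r) \<or> (\<forall>\<^sub>F t in at_top. R t < r)"
    if ev: "\<forall>\<^sub>F t in at_top. R t \<noteq> r" for r
  proof -
    obtain T0 where T0: "\<And>t. t \<ge> T0 \<Longrightarrow> R t \<noteq> r"
      using ev by (auto simp: eventually_at_top_linorder)
    obtain T where T: "T \<ge> 0" "\<And>t. t \<ge> T \<Longrightarrow> R t \<noteq> r"
      using T0 that[of "max T0 0"] by auto
    have c: "continuous_on {x..y} R" if "x \<ge> T" for x y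
      by (rule continuous_on_subset[OF cont]) (use that T in auto)
    show ?thesis
    proof (cases "R T > r")
      case True
      have "R t > r" if tT: "t \<ge> T" for t
      proof (rule ccontr)
        assume "\<not> R t > r"
        then obtain x where "T \<le> x" "R x = r"
          using IVT2'[of R t r T] c[of T t] True tT by auto
        then show False using T by auto
      qed
      then show ?thesis by (auto simp: eventually_at_top_linorder)
    next
      case False
      have "R t < r" if tT: "t \<ge> T" for t
      proof (rule ccontr)
        assume "\<not> R t < r"
        then obtain x where "T \<le> x" "R x = r"
          using IVT'[of R T r t] c[of T t] False tT by auto
        then show False using T by auto
      qed
      then show ?thesis by (auto simp: eventually_at_top_linorder)
    qed
  qed
  define A where "A = {r. \<forall>\<^sub>F t in at_top. R t > r}"
  have A_lt: "r < q" if r: "r \<in> A" for r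
  proof -
    obtain T where "\<And>t. t \<ge> T \<Longrightarrow> R t > r"
      using r by (auto simp: A_def eventually_at_top_linorder)
    then have "R (max T 0) > r" by simp
    then show ?thesis using bds(2)[of "max T 0"] by simp
  qed
  then have bdd: "bdd_above A" by (meson bdd_aboveI less_imp_le)
  have below: "r \<in> A" if "r < p" for r
    unfolding A_def mem_Collect_eq eventually_at_top_linorder
    using bds(1) that by (intro exI[of _ 0]) force
  have ne: "A \<noteq> {}" using below[of "p - 1"] by auto
  define c where "c = Sup A"
  have "p \<le> c"
    unfolding c_def by (rule dense_le) (use below cSup_upper[OF _ bdd] in auto)
  have "(R \<longlongrightarrow> c) at_top"
  proof (rule order_tendstoI)
    fix r assume "r < c"
    then obtain r' where "r' \<in> A" "r < r'" unfolding c_def using less_cSup_iff[OF ne bdd] by auto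
    then show "\<forall>\<^sub>F t in at_top. R t > r"
      unfolding A_def by (auto elim: eventually_mono)
  next
    fix r assume "r > c"
    then obtain r' where r': "c < r'" "r' < r" "\<forall>\<^sub>F t in at_top. R t \<noteq> r'"
      using dense[OF \<open>p \<le> c\<close>] by blast
    have "r' \<notin> A" using r' cSup_upper[OF _ bdd] unfolding c_def by force
    then have "\<forall>\<^sub>F t in at_top. R t < r'" using side[OF r'(3)] by (auto simp: A_def)
    then show "\<forall>\<^sub>F t in at_top. R t < r" by (rule eventually_mono) (use r' in auto)
  qed
  then show ?thesis by blast
qed

text \<open>The integer is fixed at time \<open>T\<close> by moving the phase into [-pi, pi].
  Positivity of the cosine then means distance below pi / 2 from 0, and leaving that range would
  cross a zero of the cosine.\<close>

lemma cos_pos_imp_near_multiple: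
  fixes f :: "real \<Rightarrow> real"
  assumes cont: "continuous_on {T..} f" and pos: "\<And>t. t \<ge> T \<Longrightarrow> cos (f t) > 0"
  shows "\<exists>k::int. \<forall>t\<ge>T. \<bar>f t - 2 * pi * of_int k\<bar> < pi / 2"
proof -
  define k where "k = \<lfloor>(f T + pi) / (2 * pi)\<rfloor>"
  define g where "g t = f t - 2 * pi * of_int k" for t
  have cosg: "cos (g t) = cos (f t)" for t
    by (simp add: g_def cos_diff)
  have k: "of_int k \<le> (f T + pi) / (2 * pi)" "(f T + pi) / (2 * pi) < of_int k + 1"
    unfolding k_def by linarith+
  then have gT: "- pi \<le> g T" "g T \<le> pi" by (auto simp: g_def field_simps)
  have cg: "continuous_on {T..t} g" for t unfolding g_def
    by (intro continuous_intros continuous_on_subset[OF cont]) auto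
  have no: "\<bar>g t\<bar> \<noteq> pi / 2" if "t \<ge> T" for t
  proof
    assume "\<bar>g t\<bar> = pi / 2"
    then have "cos \<bar>g t\<bar> = cos (pi / 2)" by (simp only:)
    then show False using pos[OF that] cosg[of t] by simp
  qed
  have cneg: "cos x \<le> 0" if "pi / 2 \<le> \<bar>x\<bar>" "\<bar>x\<bar> \<le> pi" for x :: real
    using cos_monotone_0_pi_le[of "pi/2" "\<bar>x\<bar>"] that by simp
  have "\<bar>g T\<bar> < pi / 2" using cneg[of "g T"] pos[of T] cosg[of T] gT by force
  have "\<bar>g t\<bar> < pi / 2" if tT: "t \<ge> T" for t
  proof (rule ccontr)
    assume "\<not> \<bar>g t\<bar> < pi / 2"
    moreover have "continuous_on {T..t} (\<lambda>x. \<bar>g x\<bar>)" by (intro continuous_intros cg)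
    ultimately obtain x where "T \<le> x" "\<bar>g x\<bar> = pi / 2"
      using IVT'[of "\<lambda>x. \<bar>g x\<bar>" T "pi/2" t] \<open>\<bar>g T\<bar> < pi / 2\<close> tT by auto
    then show False using no by auto
  qed
  then show ?thesis unfolding g_def by blast
qed

section \<open>Full turns and the oscillation of a phase\<close>

lemma cos_value_in_period:
  fixes x q :: real
  obtains p where "x \<le> p" "p \<le> x + 2 * pi" "cos p = cos q"
proof -
  define k where "k = \<lceil>(x - q) / (2 * pi)\<rceil>"
  have "(x - q) / (2 * pi) \<le> of_int k" "of_int k < (x - q) / (2 * pi) + 1"
    unfolding k_def by linarith+
  then have "x \<le> q + 2 * pi * of_int k" "q + 2 * pi * of_int k \<le> x + 2 * pi"
    by (auto simp: field_simps)
  moreover have "cos (q + 2 * pi * of_int k) = cos q" by (simp add: cos_add)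
  ultimately show ?thesis by (rule that)
qed

text \<open>A full turn visits both cos = -1 and cos = 1. Starting at or above the threshold
  \<open>c\<close>, the visit to -1 breaks persistence. Starting below it, the visit to 1 forces
  \<open>cos\<close> to stay at least \<open>c\<close> until the turn closes, where it has its
  starting value again.\<close>

lemma no_full_positive_turn:
  fixes g :: "real \<Rightarrow> real"
  assumes "a \<le> b" and cont: "continuous_on {a..b} g" and c: "-1 < c" "c \<le> 1"
    and persist: "\<And>u w. a \<le> u \<Longrightarrow> u \<le> w \<Longrightarrow> w \<le> b \<Longrightarrow> c \<le> cos (g u) \<Longrightarrow> c \<le> cos (g w)"
  shows "g b - g a < 2 * pi"
proof (rule ccontr)
  assume turn: "\<not> g b - g a < 2 * pi"
  have hit: "\<exists>u. a \<le> u \<and> u \<le> w \<and> g u = p" if "g a \<le> p" "p \<le> g w" "a \<le> w" "w \<le> b" for p w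
    using IVT'[of g a p w] continuous_on_subset[OF cont, of "{a..w}"] that by auto
  obtain y where y: "a \<le> y" "y \<le> b" "g y = g a + 2 * pi"
    using hit[of "g a + 2 * pi" b] turn \<open>a \<le> b\<close> by auto
  show False
  proof (cases "c \<le> cos (g a)")
    case True
    obtain p where p: "g a \<le> p" "p \<le> g a + 2 * pi" "cos p = cos pi"
      by (rule cos_value_in_period)
    then obtain u where u: "a \<le> u" "u \<le> y" "g u = p" using hit[of p y] y by auto
    then show False using persist[of a u] True p y c by simp
  next
    case False
    obtain p where p: "g a \<le> p" "p \<le> g a + 2 * pi" "cos p = cos 0"
      by (rule cos_value_in_period)
    then obtain u where u: "a \<le> u" "u \<le> y" "g u = p" using hit[of p y] y by auto
    then have "c \<le> cos (g y)" using persist[of u y] p y c by simp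
    then show False using False y by simp
  qed
qed

lemma no_full_turn:
  fixes g :: "real \<Rightarrow> real"
  assumes "a \<le> b" and cont: "continuous_on {a..b} g" and c: "-1 < c" "c \<le> 1"
    and persist: "\<And>u w. a \<le> u \<Longrightarrow> u \<le> w \<Longrightarrow> w \<le> b \<Longrightarrow> c \<le> cos (g u) \<Longrightarrow> c \<le> cos (g w)"
  shows "\<bar>g b - g a\<bar> < 2 * pi"
proof -
  have "g b - g a < 2 * pi"
    by (rule no_full_positive_turn[OF assms(1-4)]) (rule persist)
  moreover have "- g b - - g a < 2 * pi"
    by (rule no_full_positive_turn[OF assms(1) continuous_on_minus[OF cont] c])
      (simp only: cos_minus, rule persist)
  ultimately show ?thesis by linarith
qed

lemma oscillation_less_2pi:
  fixes f :: "real \<Rightarrow> real"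
  assumes cont: "continuous_on {0..} f" and lim: "(f \<longlongrightarrow> L) at_top" and c: "-1 < c" "c \<le> 1"
    and persist: "\<And>u w. 0 \<le> u \<Longrightarrow> u \<le> w \<Longrightarrow> c \<le> cos (f u) \<Longrightarrow> c \<le> cos (f w)"
  shows "bdd_above (f ` {0..})" "bdd_below (f ` {0..})"
    "(SUP t\<in>{0..}. f t) - (INF t\<in>{0..}. f t) < 2 * pi"
proof -
  \<comment> \<open>Compactifying time to the unit interval makes both extrema attained, which turns the
    bound on each pair of values into a strict bound on the oscillation.\<close>
  define g where "g u = (if u < 1 then f (u / (1 - u)) else L)" for u
  have cont_g: "continuous_on {0..1} g"
    unfolding continuous_on_eq_continuous_within
  proof
    fix u :: real assume u: "u \<in> {0..1}"
    show "continuous (at u within {0..1}) g"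
    proof (cases "u < 1")
      case True
      have "continuous_on {0..<1} (\<lambda>u. f (u / (1 - u)))"
        by (intro continuous_on_compose2[OF cont] continuous_intros) auto
      then have "continuous_on {0..<1} g"
        by (rule continuous_on_eq) (auto simp: g_def)
      then have "continuous (at u within {0..<1}) g"
        using u True by (simp add: continuous_on_eq_continuous_within)
      moreover have "at u within {0..1} = at u within {0..<1}"
        by (rule at_within_nhd[of _ "{..<1}"]) (use True in auto)
      ultimately show ?thesis by simp
    next
      case False
      then have [simp]: "u = 1" using u by auto
      have "filterlim (\<lambda>u::real. u / (1 - u)) at_top (at_left 1)"
        by real_asymp
      then have "((\<lambda>u. f (u / (1 - u))) \<longlongrightarrow> L) (at_left 1)"
        by (rule filterlim_compose[OF lim])
      moreover have "\<forall>\<^sub>F u in at_left 1. f (u / (1 - u)) = g u"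
        unfolding eventually_at_filter by (auto simp: g_def)
      ultimately have "(g \<longlongrightarrow> L) (at_left 1)"
        by (rule Lim_transform_eventually)
      then show ?thesis by (simp add: continuous_within at_within_Icc_at_left g_def)
    qed
  qed
  \<comment> \<open>Persistence extends to the added endpoint 1 because a weak lower bound passes to
    the limit.\<close>
  have persist_g: "c \<le> cos (g w)" if uw: "0 \<le> u" "u \<le> w" "w \<le> 1" and cu: "c \<le> cos (g u)" for u w
  proof (cases "w < 1")
    case True
    have "u / (1 - u) \<le> w / (1 - w)" using uw True by (intro frac_le) auto
    then show ?thesis using persist[of "u / (1 - u)" "w / (1 - w)"] uw cu True by (auto simp: g_def)
  next
    case False
    show ?thesis
    proof (cases "u < 1")
      case True
      have "((\<lambda>t. cos (f t)) \<longlongrightarrow> cos L) at_top" by (intro tendsto_intros lim)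
      moreover have "\<forall>\<^sub>F t in at_top. c \<le> cos (f t)"
        using eventually_ge_at_top[of "u / (1 - u)"]
        by eventually_elim (rule persist[of "u / (1 - u)"], use uw cu True in \<open>auto simp: g_def\<close>)
      ultimately have "c \<le> cos L" by (rule tendsto_lowerbound) simp
      then show ?thesis using False by (simp add: g_def)
    qed (use False cu in \<open>auto simp: g_def\<close>)
  qed
  have f_eq: "f t = g (t / (1 + t))" if "t \<ge> 0" for t
  proof -
    have "t / (1 + t) < 1" "1 - t / (1 + t) = 1 / (1 + t)" using that by (auto simp: field_simps)
    then show ?thesis using that by (simp add: g_def)
  qed
  have in_range: "t / (1 + t) \<in> {0..1}" if "t \<ge> 0" for t :: real
    using that by (auto simp: field_simps)
  obtain x where x: "x \<in> {0..1}" "\<And>u. u \<in> {0..1} \<Longrightarrow> g u \<le> g x"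
    using continuous_attains_sup[OF _ _ cont_g] by auto
  obtain y where y: "y \<in> {0..1}" "\<And>u. u \<in> {0..1} \<Longrightarrow> g y \<le> g u"
    using continuous_attains_inf[OF _ _ cont_g] by auto
  have le: "f t \<le> g x" "g y \<le> f t" if "t \<ge> 0" for t
    using f_eq[OF that] x(2)[OF in_range[OF that]] y(2)[OF in_range[OF that]] by auto
  then show "bdd_above (f ` {0..})" "bdd_below (f ` {0..})"
    by (auto intro!: bdd_aboveI[of _ "g x"] bdd_belowI[of _ "g y"])
  have turn: "\<bar>g w - g u\<bar> < 2 * pi" if "0 \<le> u" "u \<le> w" "w \<le> 1" for u w
    by (rule no_full_turn[OF \<open>u \<le> w\<close> continuous_on_subset[OF cont_g] c persist_g]) (use that in auto)
  have "g x - g y < 2 * pi"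
    using turn[of x y] turn[of y x] x(1) y(1) by (cases "x \<le> y") auto
  moreover have "(SUP t\<in>{0..}. f t) \<le> g x" by (rule cSUP_least) (use le in auto)
  moreover have "g y \<le> (INF t\<in>{0..}. f t)" by (rule cINF_greatest) (use le in auto)
  ultimately show "(SUP t\<in>{0..}. f t) - (INF t\<in>{0..}. f t) < 2 * pi" by linarith
qed

text \<open>Strictness could be lost only at infinity or in finite time. The tail lies below some
  \<open>m < c\<close>, and on the remaining compact interval the maximum is attained.\<close>

lemma SUP_less_if_limit_less:
  fixes h :: "real \<Rightarrow> real"
  assumes cont: "continuous_on {0..} h" and lim: "(h \<longlongrightarrow> l) at_top" and "l < c"
    and less: "\<And>t. t \<ge> 0 \<Longrightarrow> h t < c"
  shows "(SUP t\<in>{0..}. h t) < c"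
proof -
  obtain m where m: "l < m" "m < c" using dense[OF \<open>l < c\<close>] by blast
  obtain T0 where T0: "\<And>t. t \<ge> T0 \<Longrightarrow> h t < m"
    using order_tendstoD(2)[OF lim m(1)] by (auto simp: eventually_at_top_linorder)
  define T where "T = max T0 0"
  have "continuous_on {0..T} h" by (rule continuous_on_subset[OF cont]) auto
  then obtain x where x: "0 \<le> x" "\<And>t. 0 \<le> t \<Longrightarrow> t \<le> T \<Longrightarrow> h t \<le> h x"
    using continuous_attains_sup[of "{0..T}" h] by (auto simp: T_def)
  have "h t \<le> max (h x) m" if "t \<ge> 0" for t
  proof (cases "t \<le> T")
    case True
    then show ?thesis using x(2)[of t] that by linarith
  next
    case False
    then have "h t < m" by (intro T0) (simp add: T_def)
    then show ?thesis by linarith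
  qed
  then have "(SUP t\<in>{0..}. h t) \<le> max (h x) m" by (intro cSUP_least) auto
  then show ?thesis using less[OF x(1)] m by linarith
qed

text \<open>Mean value theorem: the slope is a cosine between \<open>y\<close> and \<open>x\<close>.
  On (-pi/2, pi/2) the cosine decreases with the distance from 0, so its minimum over that range
  sits at an endpoint.\<close>

lemma sin_diff_bounds:
  fixes x y m :: real
  assumes "y \<le> x" "\<bar>x\<bar> < pi / 2" "\<bar>y\<bar> < pi / 2" "m \<le> cos x" "m \<le> cos y"
  shows "m * (x - y) \<le> sin x - sin y" "sin x - sin y \<le> x - y"
proof -
  have "m * (x - y) \<le> sin x - sin y \<and> sin x - sin y \<le> x - y"
  proof (cases "y < x")
    case True
    then obtain z where z: "y < z" "z < x" "sin x - sin y = (x - y) * cos z"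
      using MVT2[of y x sin cos] by (auto intro: DERIV_sin)
    have "m \<le> cos z"
    proof (cases "z \<ge> 0")
      case True
      then have "cos x \<le> cos z" using z assms by (intro cos_monotone_0_pi_le) auto
      then show ?thesis using assms by simp
    next
      case False
      then have "cos (- y) \<le> cos (- z)" using z assms by (intro cos_monotone_0_pi_le) auto
      then show ?thesis using assms by simp
    qed
    then show ?thesis
      using z mult_left_mono[of m "cos z" "x - y"] mult_left_mono[of "cos z" 1 "x - y"] True
      by (simp add: mult.commute)
  qed (use assms in auto)
  then show "m * (x - y) \<le> sin x - sin y" "sin x - sin y \<le> x - y" by auto
qed

text \<open>In the variable $z = 1/r$ the equation $r = \frac1N \sum_i (1 + \sigma_i \sqrt{1 - (a_i/r)^2})$
  becomes holomorphic on a disc around the origin, where it fails at $z = 0$; so by the identity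
  theorem it cannot hold on an interval.\<close>

lemma order_parameter_equation_fails:
  fixes a \<sigma> :: "nat \<Rightarrow> real"
  assumes "d > 0" and a: "\<And>i. i < N \<Longrightarrow> \<bar>a i\<bar> \<le> d" and "d \<le> \<alpha>" "\<alpha> < \<beta>"
  shows "\<exists>r. \<alpha> < r \<and> r < \<beta> \<and> (1 / real N) * (\<Sum>i<N. 1 + \<sigma> i * sqrt (1 - (a i / r)\<^sup>2)) \<noteq> r"
proof (rule ccontr)
  assume contra: "\<not> ?thesis"
  \<comment> \<open>The equation is multiplied by \<open>z\<close> and 1 is subtracted, so that
    zeros of \<open>h\<close> at real \<open>z = 1 / r\<close> are solutions while
    \<open>h 0 = -1\<close>.\<close>
  define h :: "complex \<Rightarrow> complex" where
    "h z = z * ((1 / of_nat N) * (\<Sum>i<N. 1 + of_real (\<sigma> i) * csqrt (1 - (of_real (a i) * z)\<^sup>2))) - 1" for z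
  \<comment> \<open>Inversion of the interval between \<open>\<alpha>\<close> and
    \<open>\<beta>\<close>; \<open>d \<le> \<alpha>\<close> places it inside the disc of radius
    \<open>1 / d\<close>.\<close>
  define U where "U = complex_of_real ` {1 / \<beta><..<1 / \<alpha>}"
  have pos: "\<alpha> > 0" "\<beta> > 0" using assms by auto
  then have lt: "1 / \<beta> < 1 / \<alpha>" using assms by (simp add: frac_less2)
  then obtain x where x: "1 / \<beta> < x" "x < 1 / \<alpha>" using dense by blast
  \<comment> \<open>Hence each radicand has positive real part on the disc and avoids the branch cut
    of \<open>csqrt\<close>.\<close>
  have norm_lt: "norm ((of_real (a i) * z)\<^sup>2) < 1" if "i < N" "z \<in> ball 0 (1 / d)" for i and z :: complex
  proof -
    have "norm (of_real (a i) * z) \<le> d * norm z"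
      unfolding norm_mult using a[OF that(1)] by (intro mult_right_mono) auto
    also have "\<dots> < 1" using that(2) \<open>d > 0\<close> by (simp add: field_simps)
    finally show ?thesis by (simp add: norm_power power_less_one_iff)
  qed
  have slit: "1 - (of_real (a i) * z)\<^sup>2 \<notin> \<real>\<^sub>\<le>\<^sub>0" if "i < N" "z \<in> ball 0 (1 / d)" for i and z :: complex
  proof
    assume "1 - (of_real (a i) * z)\<^sup>2 \<in> \<real>\<^sub>\<le>\<^sub>0"
    then have "1 \<le> Re ((of_real (a i) * z)\<^sup>2)" by (auto simp: complex_nonpos_Reals_iff)
    then show False using norm_lt[OF that] complex_Re_le_cmod[of "(of_real (a i) * z)\<^sup>2"] by simp
  qed
  have "h holomorphic_on ball 0 (1 / d)"
    unfolding h_def using slit by (intro holomorphic_intros holomorphic_on_csqrt') auto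
  moreover have "U \<subseteq> ball 0 (1 / d)"
  proof
    fix z assume "z \<in> U"
    then obtain y where y: "z = of_real y" "1 / \<beta> < y" "y < 1 / \<alpha>" by (auto simp: U_def)
    have "1 / \<alpha> \<le> 1 / d" using assms by (simp add: frac_le)
    moreover have "y > 0" using y(2) pos by (meson order_less_trans zero_less_divide_1_iff)
    ultimately show "z \<in> ball 0 (1 / d)" using y by simp
  qed
  moreover have "of_real x \<in> U" using x by (auto simp: U_def)
  moreover have "of_real x islimpt U"
    unfolding islimpt_approachable
  proof (intro allI impI)
    fix e :: real assume "e > 0"
    obtain y where "x < y" "y < min (x + e) (1 / \<alpha>)"
      using dense[of x "min (x + e) (1 / \<alpha>)"] x \<open>e > 0\<close> by auto
    then have y: "x < y" "y < 1 / \<alpha>" "y - x < e" by auto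
    have "dist (complex_of_real y) (of_real x) < e"
      using y by (simp add: dist_norm of_real_diff[symmetric] del: of_real_diff)
    then show "\<exists>z\<in>U. z \<noteq> of_real x \<and> dist z (of_real x) < e"
      using y x by (intro bexI[of _ "of_real y"]) (auto simp: U_def)
  qed
  moreover have "h z = 0" if "z \<in> U" for z
  proof -
    obtain y where y: "z = of_real y" "1 / \<beta> < y" "y < 1 / \<alpha>" using \<open>z \<in> U\<close> by (auto simp: U_def)
    have "y > 0" using y(2) pos by (meson order_less_trans zero_less_divide_1_iff)
    have "z \<in> ball 0 (1 / d)" using \<open>z \<in> U\<close> \<open>U \<subseteq> ball 0 (1 / d)\<close> by blast
    have "\<alpha> < 1 / y" "1 / y < \<beta>" using y pos \<open>y > 0\<close> by (auto simp: field_simps)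
    then have eq: "(1 / real N) * (\<Sum>i<N. 1 + \<sigma> i * sqrt (1 - (a i / (1 / y))\<^sup>2)) = 1 / y"
      using contra by blast
    have "csqrt (1 - (of_real (a i) * z)\<^sup>2) = of_real (sqrt (1 - (a i * y)\<^sup>2))" if "i < N" for i
    proof -
      have "(a i * y)\<^sup>2 < 1"
        using norm_lt[OF that \<open>z \<in> ball 0 (1 / d)\<close>] by (simp add: y norm_power norm_mult power_mult_distrib)
      moreover have "1 - (of_real (a i) * z)\<^sup>2 = of_real (1 - (a i * y)\<^sup>2)" by (simp add: y)
      ultimately show ?thesis by (simp only: of_real_sqrt)
    qed
    then have "h z = of_real (y * ((1 / real N) * (\<Sum>i<N. 1 + \<sigma> i * sqrt (1 - (a i / (1 / y))\<^sup>2))) - 1)"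
      by (simp add: h_def y)
    then show ?thesis unfolding eq using \<open>y > 0\<close> by simp
  qed
  ultimately have "h 0 = 0"
    using \<open>d > 0\<close> by (intro analytic_continuation[of h "ball 0 (1 / d)" U "of_real x" 0]) auto
  then show False by (simp add: h_def)
qed

text \<open>\<open>arcsin\<close> inverts \<open>sin\<close> only on the central branch, so the
  branch number is fixed beforehand and added back. The strict bound on \<open>s\<close> keeps the
  limit inside the interval where \<open>arcsin\<close> is continuous.\<close>

lemma tendsto_arcsin_of_sin:
  fixes f :: "real \<Rightarrow> real"
  assumes sin: "((\<lambda>t. sin (f t)) \<longlongrightarrow> s) at_top" and s: "\<bar>s\<bar> < 1"
    and near: "\<And>t. t \<ge> T \<Longrightarrow> \<bar>f t - 2 * pi * of_int k\<bar> < pi / 2"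
  shows "(f \<longlongrightarrow> arcsin s + 2 * pi * of_int k) at_top"
proof -
  have "((\<lambda>t. arcsin (sin (f t)) + 2 * pi * of_int k) \<longlongrightarrow> arcsin s + 2 * pi * of_int k) at_top"
    by (intro tendsto_add tendsto_const isCont_tendsto_compose[OF isCont_arcsin sin]) (use s in auto)
  moreover have "\<forall>\<^sub>F t in at_top. arcsin (sin (f t)) + 2 * pi * of_int k = f t"
    using eventually_ge_at_top[of T]
  proof eventually_elim
    case (elim t)
    have "sin (f t) = sin (f t - 2 * pi * of_int k)" by (simp add: sin_diff)
    moreover have "arcsin (sin (f t - 2 * pi * of_int k)) = f t - 2 * pi * of_int k"
      by (rule arcsin_sin) (use near[OF elim] in linarith)+
    ultimately show ?case by simp
  qed
  ultimately show ?thesis by (rule Lim_transform_eventually)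
qed

section \<open>The Winfree model\<close>

locale winfree =
  fixes N :: nat and \<omega> :: "nat \<Rightarrow> real" and \<kappa> \<mu> :: real
    and \<theta> :: "real \<Rightarrow> nat \<Rightarrow> real"
  assumes N: "N \<ge> 1"
    and ode: "\<And>i t. i < N \<Longrightarrow> t \<ge> 0 \<Longrightarrow>
      ((\<lambda>s. \<theta> s i) has_real_derivative vel N \<omega> \<kappa> \<theta> i t) (at t within {0..})"
    and mu: "0 < \<mu>" "\<mu> < min (orderR N \<theta> 0) 1"
    and kappa: "\<kappa> > normInf N \<omega> / ((orderR N \<theta> 0 - \<mu>) * sqrt (\<mu> * (2 - \<mu>)))"
begin

abbreviation R :: "real \<Rightarrow> real" where "R \<equiv> orderR N \<theta>"
abbreviation v :: "nat \<Rightarrow> real \<Rightarrow> real" where "v \<equiv> vel N \<omega> \<kappa> \<theta>"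
abbreviation W :: real where "W \<equiv> normInf N \<omega>"
abbreviation \<rho> :: real where "\<rho> \<equiv> R 0 - \<mu>"
text \<open>This is the least value of |sin x| on the strip |cos x| \<le> 1 - \<mu>, since 1 - (1 -
  \<mu>)^2 = \<mu> (2 - \<mu>).\<close>

definition S :: real where "S = sqrt (\<mu> * (2 - \<mu>))"

lemma mu_less_1: "\<mu> < 1" and rho_pos: "\<rho> > 0"
  using mu by auto

lemma S_sq: "S\<^sup>2 = \<mu> * (2 - \<mu>)" and S_pos: "S > 0" and S_le_1: "S \<le> 1"
proof -
  show "S\<^sup>2 = \<mu> * (2 - \<mu>)" "S > 0" using mu by (auto simp: S_def)
  have "\<mu> * (2 - \<mu>) \<le> 1" using zero_le_power2[of "\<mu> - 1"] by (simp add: power2_eq_square algebra_simps)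
  then show "S \<le> 1" by (simp add: S_def)
qed

lemma abs_omega_le: "i < N \<Longrightarrow> \<bar>\<omega> i\<bar> \<le> W"
  unfolding normInf_def by (rule Max_ge) auto

lemma W_nonneg: "W \<ge> 0"
  using abs_omega_le[of 0] N by linarith

lemma gap: "W < \<kappa> * \<rho> * S"
  using kappa rho_pos S_pos by (simp add: S_def[symmetric] pos_divide_less_eq mult.assoc)

lemma kappa_pos: "\<kappa> > 0"
proof -
  have "0 < \<kappa> * (\<rho> * S)" using gap W_nonneg by (simp add: mult.assoc)
  then show ?thesis using mult_pos_pos[OF rho_pos S_pos] by (metis zero_less_mult_pos2)
qed

lemma v_eq: "v i t = \<omega> i - \<kappa> * R t * sin (\<theta> t i)"
  by (simp add: vel_def orderR_def)

lemma R_nonneg: "R t \<ge> 0"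
proof -
  have "0 \<le> 1 + cos x" for x :: real using cos_ge_minus_one[of x] by linarith
  then show ?thesis unfolding orderR_def by (intro mult_nonneg_nonneg sum_nonneg) auto
qed

lemma R_le_2: "R t \<le> 2"
proof -
  have "(\<Sum>j<N. 1 + cos (\<theta> t j)) \<le> (\<Sum>j<N. 2)"
    by (rule sum_mono) (use cos_le_one in auto)
  then show ?thesis using N by (simp add: orderR_def field_simps)
qed

lemma theta_deriv:
  assumes "i < N" "0 \<le> a" "a \<le> t"
  shows "((\<lambda>s. \<theta> s i) has_real_derivative v i t) (at t within {a..b})"
  by (rule DERIV_subset[OF ode]) (use assms in auto)

lemma continuous_theta: "i < N \<Longrightarrow> A \<subseteq> {0..} \<Longrightarrow> continuous_on A (\<lambda>s. \<theta> s i)"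
  by (rule continuous_on_subset[OF DERIV_continuous_on[OF ode]]) auto

lemma continuous_R: "A \<subseteq> {0..} \<Longrightarrow> continuous_on A R"
  unfolding orderR_def by (intro continuous_intros continuous_theta) auto

section \<open>The repelling strip and the lower bound on the order parameter\<close>

lemma abs_sin_ge_S:
  assumes "\<bar>cos x\<bar> \<le> 1 - \<mu>"
  shows "S \<le> \<bar>sin x\<bar>"
proof -
  have "(cos x)\<^sup>2 \<le> (1 - \<mu>)\<^sup>2" using assms by (metis abs_ge_zero power2_abs power_mono)
  then have "S\<^sup>2 \<le> \<bar>sin x\<bar>\<^sup>2"
    unfolding S_sq power2_abs sin_squared_eq by (simp add: power2_eq_square algebra_simps)
  then show ?thesis by (rule power2_le_imp_le) simp
qed

text \<open>The level \<open>r\<close> stays free because the bootstrap uses it slightly below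
  \<open>\<rho>\<close>. Its positivity comes out of the first hypothesis, as \<open>W\<close>,
  \<open>\<kappa>\<close> and \<open>S\<close> have known signs.\<close>

lemma coupling_dominates:
  assumes "W < \<kappa> * r * S" "r \<le> R t" "S \<le> \<bar>sin x\<bar>"
  shows "\<kappa> * r * S \<le> \<kappa> * R t * \<bar>sin x\<bar>"
proof -
  have "0 < \<kappa> * (r * S)" using assms W_nonneg by (simp add: mult.assoc)
  then have "r > 0" using kappa_pos S_pos by (simp add: zero_less_mult_iff)
  then show ?thesis using assms kappa_pos S_pos by (intro mult_mono) auto
qed

text \<open>On the level, the derivative of cos \<theta>_i is \<kappa> R sin^2 - \<omega>_i sin
  \<ge> |sin| (\<kappa> R |sin| - \<open>W\<close>), and in the strip the bracket is
  positive.\<close>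

lemma cos_barrier:
  assumes "i < N" "0 \<le> a" "a \<le> b" and r: "W < \<kappa> * r * S"
    and Rr: "\<And>t. a \<le> t \<Longrightarrow> t \<le> b \<Longrightarrow> r \<le> R t"
    and c: "\<bar>c\<bar> \<le> 1 - \<mu>" and init: "c \<le> cos (\<theta> a i)"
  shows "c \<le> cos (\<theta> b i)"
proof (rule strict_barrier[OF \<open>a \<le> b\<close>])
  show "((\<lambda>s. cos (\<theta> s i)) has_real_derivative - sin (\<theta> t i) * v i t) (at t within {a..b})"
    if "a \<le> t" "t \<le> b" for t
    using theta_deriv[of i a t b] assms that by (auto intro!: derivative_eq_intros)
  fix t assume t: "a \<le> t" "t \<le> b" "cos (\<theta> t i) = c"
  let ?s = "sin (\<theta> t i)"
  have S: "S \<le> \<bar>?s\<bar>" using abs_sin_ge_S t c by simp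
  have "W < \<kappa> * R t * \<bar>?s\<bar>" using coupling_dominates[OF r Rr S, of t] r t by simp
  then have "W * \<bar>?s\<bar> < \<kappa> * R t * \<bar>?s\<bar> * \<bar>?s\<bar>"
    by (rule mult_strict_right_mono) (use S S_pos in linarith)
  moreover have "\<omega> i * ?s \<le> W * \<bar>?s\<bar>"
    using mult_right_mono[OF abs_omega_le[OF \<open>i < N\<close>], of "\<bar>?s\<bar>"] by (simp add: abs_mult[symmetric])
  moreover have "\<kappa> * R t * \<bar>?s\<bar> * \<bar>?s\<bar> = \<kappa> * R t * ?s * ?s"
    by (simp add: mult.assoc)
  ultimately show "0 < - sin (\<theta> t i) * v i t"
    by (simp add: v_eq algebra_simps)
qed (use init in auto)

text \<open>The self-improving half of the bootstrap: a bound by any admissible \<open>r\<close> on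
  the whole interval yields the bound by \<open>\<rho>\<close> at its end. An oscillator starting
  below the strip has less than \<mu> to lose, as cos \<ge> -1; the others are held by the
  barrier.\<close>

lemma R_lower_bound_step:
  assumes "T \<ge> 0" and r: "W < \<kappa> * r * S" and Rr: "\<And>t. 0 \<le> t \<Longrightarrow> t \<le> T \<Longrightarrow> r \<le> R t"
  shows "\<rho> \<le> R T"
proof -
  have "cos (\<theta> 0 i) - \<mu> \<le> cos (\<theta> T i)" if "i < N" for i
  proof (cases "cos (\<theta> 0 i) \<ge> -1 + \<mu>")
    case True
    \<comment> \<open>The cap keeps the level inside the strip. A phase starting above
      \<open>1 - \<mu>\<close> may drop to that value, which costs at most \<mu>.\<close>
    have "min (cos (\<theta> 0 i)) (1 - \<mu>) \<le> cos (\<theta> T i)"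
      by (rule cos_barrier[OF that order.refl \<open>T \<ge> 0\<close> r Rr])
        (use True mu_less_1 in auto)
    then show ?thesis using cos_le_one[of "\<theta> 0 i"] mu by linarith
  next
    case False
    then show ?thesis using cos_ge_minus_one[of "\<theta> T i"] by linarith
  qed
  then have "(\<Sum>i<N. 1 + cos (\<theta> 0 i) - \<mu>) \<le> (\<Sum>i<N. 1 + cos (\<theta> T i))"
    by (intro sum_mono) force
  then have "(\<Sum>i<N. 1 + cos (\<theta> 0 i)) - N * \<mu> \<le> (\<Sum>i<N. 1 + cos (\<theta> T i))"
    by (simp add: sum_subtractf)
  then have "1 / N * ((\<Sum>i<N. 1 + cos (\<theta> 0 i)) - N * \<mu>) \<le> 1 / N * (\<Sum>i<N. 1 + cos (\<theta> T i))"
    by (rule mult_left_mono) simp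
  then show ?thesis using N by (simp add: orderR_def right_diff_distrib)
qed

lemma R_lower_bound:
  assumes "t \<ge> 0"
  shows "\<rho> \<le> R t"
proof (rule ccontr)
  assume "\<not> \<rho> \<le> R t"
  have "W / (\<kappa> * S) < \<rho>" using gap kappa_pos S_pos by (simp add: pos_divide_less_eq ac_simps)
  \<comment> \<open>The first time $R$ reaches a level $r < \rho$ at which the strip is still repelling contradicts
    the bound $R \ge \rho$ there.\<close>
  then obtain r where r: "W / (\<kappa> * S) < r" "r < \<rho>" using dense by blast
  then have gap_r: "W < \<kappa> * r * S" using kappa_pos S_pos by (simp add: pos_divide_less_eq ac_simps)
  have "\<not> (\<forall>x\<in>{0..t}. r \<le> R x)"
    using R_lower_bound_step[OF assms gap_r] \<open>\<not> \<rho> \<le> R t\<close> by (metis atLeastAtMost_iff)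
  then obtain x where x: "0 \<le> x" "R x < r" by force
  \<comment> \<open>Reversing both time and sign turns the last crossing into the first time at
    which \<open>R\<close> reaches \<open>r\<close>.\<close>
  have "continuous_on {-x..0} (\<lambda>y. - R (- y))"
    by (intro continuous_intros continuous_on_compose2[OF continuous_R[of "{0..}"]]) auto
  then obtain s where s: "- x \<le> s" "s < 0" "R (- s) = r" "\<And>y. s < y \<Longrightarrow> y \<le> 0 \<Longrightarrow> - R (- y) < - r"
    using last_crossing[of "-x" 0 "\<lambda>y. - R (- y)" "- r"] x r mu by auto
  have "\<rho> \<le> R (- s)"
  proof (rule R_lower_bound_step[OF _ gap_r])
    fix t assume "0 \<le> t" "t \<le> - s"
    then show "r \<le> R t" using s(4)[of "- t"] s(3) by (cases "t = - s") auto
  qed (use s in auto)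
  then show False using s r by simp
qed

section \<open>Persistence and the time needed to cross the strip\<close>

lemma cos_persists:
  assumes "i < N" "0 \<le> a" "a \<le> b" "\<bar>c\<bar> \<le> 1 - \<mu>" "c \<le> cos (\<theta> a i)"
  shows "c \<le> cos (\<theta> b i)"
  using cos_barrier[OF assms(1-3) gap _ assms(4,5)] R_lower_bound assms(2) by auto

text \<open>In the strip the angular speed is at least \<open>\<kappa> * \<rho> * S - W\<close>, so
  half a turn takes at most this time. The rate \<open>lam\<close> below is \<kappa> times the lower
  bound \<open>\<rho>\<close> of \<open>R\<close> times the lower bound \<open>1 - \<mu>\<close> of
  the slope of sin near 0.\<close>

abbreviation \<tau> :: real where "\<tau> \<equiv> pi / (\<kappa> * \<rho> * S - W)"
abbreviation lam :: real where "lam \<equiv> \<kappa> * \<rho> * (1 - \<mu>)"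

lemma lam_pos: "lam > 0"
  using kappa_pos rho_pos mu_less_1 by simp

lemma turning_time_pos: "0 < \<tau>"
  using gap by simp

text \<open>Otherwise the phase would spend all of [t0, t] in the strip, moving in one direction
  with sin of constant sign. In time \<open>\<tau>\<close> it would advance by pi, and half a turn
  reverses the sign of sin.\<close>

lemma cos_eventually_large:
  assumes "i < N" "0 \<le> t0" and t: "t0 + \<tau> \<le> t"
    and init: "-1 + \<mu> \<le> cos (\<theta> t0 i)"
  shows "1 - \<mu> \<le> cos (\<theta> t i)"
proof (rule ccontr)
  assume small: "\<not> 1 - \<mu> \<le> cos (\<theta> t i)"
  have "t0 \<le> t" using t turning_time_pos by linarith
  have S: "S \<le> \<bar>sin (\<theta> x i)\<bar>" if "t0 \<le> x" "x \<le> t" for x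
  proof (rule abs_sin_ge_S)
    have "-1 + \<mu> \<le> cos (\<theta> x i)"
      by (rule cos_persists[OF \<open>i < N\<close> \<open>0 \<le> t0\<close> that(1) _ init]) (use mu_less_1 in simp)
    \<comment> \<open>Contrapositive of persistence at the upper threshold: a phase above it at time
      \<open>x\<close> could not be below it at time \<open>t\<close>.\<close>
    moreover have "cos (\<theta> x i) \<le> 1 - \<mu>"
      using cos_persists[of i x t "1 - \<mu>"] \<open>i < N\<close> \<open>0 \<le> t0\<close> that small mu_less_1 by force
    ultimately show "\<bar>cos (\<theta> x i)\<bar> \<le> 1 - \<mu>" by simp
  qed
  \<comment> \<open>The sign of sin fixes the direction of motion, so both sides of the circle are
    treated at once through \<open>- \<sigma> * \<theta>\<close>.\<close>
  define \<sigma> where "\<sigma> = sgn (sin (\<theta> t0 i))"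
  have "sin (\<theta> t0 i) \<noteq> 0" using S[of t0] S_pos \<open>t0 \<le> t\<close> by auto
  then have \<sigma>: "\<sigma> = 1 \<or> \<sigma> = -1" and pos0: "\<sigma> * sin (\<theta> t0 i) > 0"
    by (auto simp: \<sigma>_def sgn_if)
  have cont: "continuous_on {t0..x} (\<lambda>s. \<theta> s i)" for x
    by (rule continuous_theta) (use assms in auto)
  have sign: "S \<le> \<sigma> * sin (\<theta> x i)" if x: "t0 \<le> x" "x \<le> t" for x
  proof (rule ccontr)
    assume "\<not> S \<le> \<sigma> * sin (\<theta> x i)"
    then have "\<sigma> * sin (\<theta> x i) \<le> 0" using S[OF x] S_pos \<sigma> by (auto simp: abs_if split: if_splits)
    then obtain y where "t0 \<le> y" "y \<le> x" "\<sigma> * sin (\<theta> y i) = 0"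
      using IVT2'[of "\<lambda>s. \<sigma> * sin (\<theta> s i)" x 0 t0] pos0 x
        continuous_on_mult[OF continuous_on_const continuous_on_sin[OF cont[of x]], of \<sigma>] by auto
    then show False using S[of y] x S_pos \<sigma> by auto
  qed
  have "(\<kappa> * \<rho> * S - W) * (t - t0) \<le> (- \<sigma> * \<theta> t i) - (- \<sigma> * \<theta> t0 i)"
  proof (rule deriv_lower_bound_imp_growth[OF \<open>t0 \<le> t\<close>])
    fix x assume x: "t0 \<le> x" "x \<le> t"
    show "((\<lambda>s. - \<sigma> * \<theta> s i) has_real_derivative - \<sigma> * v i x) (at x within {t0..t})"
      using theta_deriv[of i t0 x t] x assms by (intro DERIV_cmult) auto
    have "\<sigma> * sin (\<theta> x i) = \<bar>sin (\<theta> x i)\<bar>" using sign[OF x] S_pos \<sigma> by auto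
    then have "\<kappa> * \<rho> * S \<le> \<kappa> * R x * (\<sigma> * sin (\<theta> x i))"
      using coupling_dominates[OF gap R_lower_bound S[OF x]] x assms by auto
    moreover have "\<sigma> * \<omega> i \<le> W" using abs_omega_le[OF \<open>i < N\<close>] \<sigma> by auto
    ultimately show "\<kappa> * \<rho> * S - W \<le> - \<sigma> * v i x" by (simp add: v_eq algebra_simps)
  qed
  moreover have "pi \<le> (\<kappa> * \<rho> * S - W) * (t - t0)"
    using t gap by (simp add: field_simps)
  ultimately have turned: "- \<sigma> * \<theta> t0 i + pi \<le> - \<sigma> * \<theta> t i" by linarith
  have "continuous_on {t0..t} (\<lambda>s. - \<sigma> * \<theta> s i)" by (intro continuous_intros cont)
  then obtain y where y: "t0 \<le> y" "y \<le> t" "- \<sigma> * \<theta> y i = - \<sigma> * \<theta> t0 i + pi"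
    using IVT'[of "\<lambda>s. - \<sigma> * \<theta> s i" t0 "- \<sigma> * \<theta> t0 i + pi" t] turned \<open>t0 \<le> t\<close> by auto
  then have "\<theta> y i = \<theta> t0 i - pi \<or> \<theta> y i = \<theta> t0 i + pi" using \<sigma> by auto
  then have "sin (\<theta> y i) = - sin (\<theta> t0 i)" by (auto simp: sin_diff)
  then show False using sign[OF y(1,2)] S_pos pos0 by simp
qed

section \<open>Bounded phases, gradient structure and vanishing velocities\<close>

lemma theta_bounded:
  assumes "i < N" "0 \<le> t"
  shows "\<bar>\<theta> t i\<bar> \<le> \<bar>\<theta> 0 i\<bar> + 2 * pi"
proof -
  have "\<bar>\<theta> t i - \<theta> 0 i\<bar> < 2 * pi"
  proof (rule no_full_turn[OF \<open>0 \<le> t\<close>])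
    show "continuous_on {0..t} (\<lambda>s. \<theta> s i)" by (rule continuous_theta) (use assms in auto)
    show "-1 + \<mu> \<le> cos (\<theta> w i)" if "0 \<le> u" "u \<le> w" "w \<le> t" "-1 + \<mu> \<le> cos (\<theta> u i)" for u w
      by (rule cos_persists[OF \<open>i < N\<close> that(1,2) _ that(4)]) (use mu_less_1 in simp)
  qed (use mu mu_less_1 in auto)
  then show ?thesis by linarith
qed

lemma abs_v_le:
  assumes "i < N"
  shows "\<bar>v i t\<bar> \<le> W + 2 * \<kappa>"
proof -
  have "\<bar>\<kappa> * R t * sin (\<theta> t i)\<bar> \<le> \<kappa> * 2 * 1"
    unfolding abs_mult using R_nonneg R_le_2 kappa_pos by (intro mult_mono) auto
  then show ?thesis using abs_omega_le[OF assms] unfolding v_eq by linarith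
qed

definition R' :: "real \<Rightarrow> real" where
  "R' t = (1 / real N) * (\<Sum>j<N. - sin (\<theta> t j) * v j t)"

lemma R_deriv: "t \<ge> 0 \<Longrightarrow> (R has_real_derivative R' t) (at t within {0..})"
  unfolding orderR_def R'_def
  by (intro DERIV_cmult DERIV_sum) (auto intro!: derivative_eq_intros ode)

lemma abs_R'_le: "\<bar>R' t\<bar> \<le> W + 2 * \<kappa>"
proof -
  have "\<bar>- sin (\<theta> t j) * v j t\<bar> \<le> 1 * (W + 2 * \<kappa>)" if "j < N" for j
    unfolding abs_mult using abs_v_le[OF that] by (intro mult_mono) auto
  then have "\<bar>\<Sum>j<N. - sin (\<theta> t j) * v j t\<bar> \<le> (\<Sum>j<N. W + 2 * \<kappa>)"
    by (intro order_trans[OF sum_abs] sum_mono) auto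
  then show ?thesis using N by (simp add: R'_def abs_mult field_simps)
qed

definition v' :: "nat \<Rightarrow> real \<Rightarrow> real" where
  "v' i t = - \<kappa> * (R' t * sin (\<theta> t i) + R t * (cos (\<theta> t i) * v i t))"

lemma v_deriv: "i < N \<Longrightarrow> t \<ge> 0 \<Longrightarrow> (v i has_real_derivative v' i t) (at t within {0..})"
  unfolding v_eq[abs_def] v'_def
  by (auto intro!: derivative_eq_intros ode R_deriv simp: v_eq algebra_simps)

lemma abs_v'_le:
  assumes "i < N"
  shows "\<bar>v' i t\<bar> \<le> 3 * \<kappa> * (W + 2 * \<kappa>)"
proof -
  let ?B = "W + 2 * \<kappa>"
  have "?B \<ge> 0" using W_nonneg kappa_pos by simp
  have "\<bar>R' t * sin (\<theta> t i)\<bar> \<le> ?B * 1"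
    unfolding abs_mult using abs_R'_le \<open>?B \<ge> 0\<close> by (intro mult_mono) auto
  moreover have "\<bar>R t * (cos (\<theta> t i) * v i t)\<bar> \<le> 2 * (1 * ?B)"
    unfolding abs_mult using abs_v_le[OF assms] R_nonneg R_le_2 \<open>?B \<ge> 0\<close> by (intro mult_mono) auto
  ultimately have "\<bar>R' t * sin (\<theta> t i) + R t * (cos (\<theta> t i) * v i t)\<bar> \<le> 3 * ?B" by linarith
  then have "\<kappa> * \<bar>R' t * sin (\<theta> t i) + R t * (cos (\<theta> t i) * v i t)\<bar> \<le> \<kappa> * (3 * ?B)"
    using kappa_pos by (intro mult_left_mono) auto
  then show ?thesis using kappa_pos by (simp add: v'_def abs_mult mult.assoc mult.left_commute)
qed

text \<open>The system is the gradient flow of $\sum_i \omega_i \theta_i + \frac{\kappa N}{2} R^2$, which is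
  bounded along the solution.\<close>

lemma sum_v_sq_tendsto_0: "((\<lambda>t. \<Sum>i<N. (v i t)\<^sup>2) \<longlongrightarrow> 0) at_top"
proof (rule barbalat)
  let ?B = "W + 2 * \<kappa>"
  let ?E = "\<lambda>t. (\<Sum>i<N. \<omega> i * \<theta> t i) + \<kappa> * N / 2 * (R t)\<^sup>2"
  show "(?E has_real_derivative (\<Sum>i<N. (v i t)\<^sup>2)) (at t within {0..})" if "t \<ge> 0" for t
  proof -
    have "\<kappa> * N / 2 * (2 * (R t * R' t)) = (\<Sum>i<N. - (\<kappa> * R t * sin (\<theta> t i)) * v i t)"
      using N by (simp add: R'_def sum_distrib_left sum_negf ac_simps)
    then have "(\<Sum>i<N. \<omega> i * v i t) + \<kappa> * N / 2 * (2 * (R t * R' t)) = (\<Sum>i<N. (v i t)\<^sup>2)"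
      by (simp add: sum.distrib[symmetric] power2_eq_square v_eq left_diff_distrib sum_subtractf sum_negf)
    moreover have "(?E has_real_derivative (\<Sum>i<N. \<omega> i * v i t) + \<kappa> * N / 2 * (2 * (R t * R' t)))
        (at t within {0..})"
      by (intro DERIV_add DERIV_cmult DERIV_sum)
        (use that in \<open>auto intro!: derivative_eq_intros ode R_deriv\<close>)
    ultimately show ?thesis by simp
  qed
  show "?E t \<le> (\<Sum>i<N. \<bar>\<omega> i\<bar> * (\<bar>\<theta> 0 i\<bar> + 2 * pi)) + \<kappa> * N / 2 * 2\<^sup>2" if "t \<ge> 0" for t
  proof (intro add_mono sum_mono mult_left_mono power_mono)
    show "\<omega> i * \<theta> t i \<le> \<bar>\<omega> i\<bar> * (\<bar>\<theta> 0 i\<bar> + 2 * pi)" if "i \<in> {..<N}" for i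
    proof -
      have "\<omega> i * \<theta> t i \<le> \<bar>\<omega> i\<bar> * \<bar>\<theta> t i\<bar>" by (metis abs_ge_self abs_mult)
      also have "\<dots> \<le> \<bar>\<omega> i\<bar> * (\<bar>\<theta> 0 i\<bar> + 2 * pi)"
        using theta_bounded[of i t] that \<open>t \<ge> 0\<close> by (intro mult_left_mono) auto
      finally show ?thesis .
    qed
  qed (use kappa_pos R_le_2 R_nonneg in auto)
  \<comment> \<open>A Lipschitz constant for the sum of squares: each term has derivative 2 v v',
    with |v| \<le> \<open>?B\<close> and |v'| \<le> 3 \<kappa> \<open>?B\<close>.\<close>
  let ?K = "N * (2 * (?B * (3 * \<kappa> * ?B)))"
  have "?B > 0" using W_nonneg kappa_pos by simp
  then show "?K > 0" using N kappa_pos by simp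
  show "(\<Sum>i<N. (v i s)\<^sup>2) - (\<Sum>i<N. (v i t)\<^sup>2) \<le> ?K * (t - s)" if st: "0 \<le> s" "s \<le> t" for s t
  proof -
    have "- ?K * (t - s) \<le> (\<Sum>i<N. (v i t)\<^sup>2) - (\<Sum>i<N. (v i s)\<^sup>2)"
    proof (rule deriv_lower_bound_imp_growth[OF \<open>s \<le> t\<close>])
      fix x assume x: "s \<le> x" "x \<le> t"
      have "((\<lambda>x. \<Sum>i<N. (v i x)\<^sup>2) has_real_derivative (\<Sum>i<N. 2 * (v i x * v' i x))) (at x within {0..})"
        using x st by (intro DERIV_sum) (auto intro!: derivative_eq_intros v_deriv)
      then show "((\<lambda>x. \<Sum>i<N. (v i x)\<^sup>2) has_real_derivative (\<Sum>i<N. 2 * (v i x * v' i x))) (at x within {s..t})"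
        by (rule DERIV_subset) (use st in auto)
      have "2 * - (?B * (3 * \<kappa> * ?B)) \<le> 2 * (v i x * v' i x)" if "i < N" for i
      proof -
        have "\<bar>v i x * v' i x\<bar> \<le> ?B * (3 * \<kappa> * ?B)"
          unfolding abs_mult using abs_v_le[OF that] abs_v'_le[OF that] \<open>?B > 0\<close> by (intro mult_mono) auto
        then show ?thesis by linarith
      qed
      then have "(\<Sum>i<N. 2 * - (?B * (3 * \<kappa> * ?B))) \<le> (\<Sum>i<N. 2 * (v i x * v' i x))"
        by (intro sum_mono) auto
      then show "- ?K \<le> (\<Sum>i<N. 2 * (v i x * v' i x))" by simp
    qed
    then show ?thesis unfolding mult_minus_left by linarith
  qed
qed (auto intro: sum_nonneg)

lemma v_tendsto_0:
  assumes "i < N"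
  shows "(v i \<longlongrightarrow> 0) at_top"
proof (rule Lim_null_comparison)
  show "((\<lambda>t. sqrt (\<Sum>i<N. (v i t)\<^sup>2)) \<longlongrightarrow> 0) at_top"
    using tendsto_real_sqrt[OF sum_v_sq_tendsto_0] by simp
  have "(v i t)\<^sup>2 \<le> (\<Sum>i<N. (v i t)\<^sup>2)" for t
    by (rule member_le_sum) (use assms in auto)
  then show "\<forall>\<^sub>F t in at_top. norm (v i t) \<le> sqrt (\<Sum>i<N. (v i t)\<^sup>2)"
    by (intro always_eventually allI) (simp add: real_le_rsqrt)
qed

section \<open>The dichotomy and convergence of the order parameter\<close>

definition eventually_up :: "nat \<Rightarrow> bool" where
  "eventually_up i \<longleftrightarrow> (\<exists>t\<ge>0. -1 + \<mu> \<le> cos (\<theta> t i))"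

definition cos_sign :: "nat \<Rightarrow> real" where
  "cos_sign i = (if eventually_up i then 1 else -1)"

text \<open>A single visit to cos \<ge> -1 + \<mu> leads to cos \<ge> 1 - \<mu> > 0 for good after a
  further time \<open>\<tau>\<close>; without any visit, cos stays below -1 + \<mu> < 0.\<close>

lemma cos_sign_times_cos_pos:
  assumes "i < N"
  obtains T where "T \<ge> 0" "\<And>t. t \<ge> T \<Longrightarrow> cos_sign i * cos (\<theta> t i) > 0"
proof (cases "eventually_up i")
  case True
  then obtain t0 where t0: "t0 \<ge> 0" "-1 + \<mu> \<le> cos (\<theta> t0 i)" by (auto simp: eventually_up_def)
  show ?thesis
  proof (rule that)
    show "0 \<le> t0 + \<tau>" using t0 turning_time_pos by linarith
    show "cos_sign i * cos (\<theta> t i) > 0" if "t \<ge> t0 + \<tau>" for t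
      using cos_eventually_large[OF assms t0(1) that t0(2)] mu_less_1 True by (simp add: cos_sign_def)
  qed
next
  case False
  then have "cos_sign i * cos (\<theta> t i) > 0" if "t \<ge> 0" for t
    using that mu_less_1 by (force simp: eventually_up_def cos_sign_def)
  then show ?thesis using that[of 0] by simp
qed

lemma eventually_cos_eq:
  assumes "i < N"
  shows "\<forall>\<^sub>F t in at_top. cos (\<theta> t i) = cos_sign i * sqrt (1 - (sin (\<theta> t i))\<^sup>2)"
proof -
  obtain T where T: "T \<ge> 0" "\<And>t. t \<ge> T \<Longrightarrow> cos_sign i * cos (\<theta> t i) > 0"
    using cos_sign_times_cos_pos[OF assms] by blast
  show ?thesis using eventually_ge_at_top[of T]
  proof eventually_elim
    case (elim t)
    have "sqrt (1 - (sin (\<theta> t i))\<^sup>2) = \<bar>cos (\<theta> t i)\<bar>" by (simp add: cos_squared_eq[symmetric])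
    then show ?case using T(2)[OF elim] by (auto simp: cos_sign_def abs_if split: if_splits)
  qed
qed

text \<open>At a late time with \<open>R t = r\<close>, solving the velocity formula for sin makes
  \<open>R t\<close> equal to \<open>?H t\<close>. Since the velocities vanish, \<open>?H\<close>
  tends to the left side of \<open>ne\<close>, which differs from \<open>r\<close>.\<close>

lemma R_avoids:
  assumes "r > 0" and ne: "(1 / real N) * (\<Sum>i<N. 1 + cos_sign i * sqrt (1 - (\<omega> i / \<kappa> / r)\<^sup>2)) \<noteq> r"
  shows "\<forall>\<^sub>F t in at_top. R t \<noteq> r"
proof -
  \<comment> \<open>The division is by the fixed \<open>r\<close>, not by \<open>R t\<close>, so the
    limit of \<open>?H\<close> is available before \<open>R\<close> is known to converge.\<close>
  let ?H = "\<lambda>t. (1 / real N) * (\<Sum>i<N. 1 + cos_sign i * sqrt (1 - ((\<omega> i - v i t) / \<kappa> / r)\<^sup>2))"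
  have "(?H \<longlongrightarrow> (1 / real N) * (\<Sum>i<N. 1 + cos_sign i * sqrt (1 - ((\<omega> i - 0) / \<kappa> / r)\<^sup>2))) at_top"
    using assms kappa_pos by (intro tendsto_intros v_tendsto_0) auto
  then have "\<forall>\<^sub>F t in at_top. ?H t \<noteq> r"
    by (rule tendsto_imp_eventually_ne) (use ne in simp)
  moreover have "\<forall>\<^sub>F t in at_top. \<forall>i\<in>{..<N}. cos (\<theta> t i) = cos_sign i * sqrt (1 - (sin (\<theta> t i))\<^sup>2)"
    using eventually_cos_eq by (intro eventually_ball_finite) auto
  ultimately show ?thesis
  proof eventually_elim
    case (elim t)
    show ?case
    proof
      assume r: "R t = r"
      have "(\<omega> i - v i t) / \<kappa> / r = sin (\<theta> t i)" for i
        using r kappa_pos \<open>r > 0\<close> by (simp add: v_eq)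
      then have "?H t = R t"
        unfolding orderR_def using elim(2) by (intro arg_cong2[where f = "(*)"] sum.cong) auto
      then show False using elim(1) r by simp
    qed
  qed
qed

lemma W_less: "W < \<kappa> * \<rho>"
proof -
  have "\<kappa> * \<rho> * S \<le> \<kappa> * \<rho> * 1"
    using kappa_pos rho_pos S_le_1 by (intro mult_left_mono) auto
  then show ?thesis using gap by linarith
qed

lemma R_convergent: "\<exists>Rinf. (R \<longlongrightarrow> Rinf) at_top"
proof (rule tendsto_at_top_if_avoids_dense[OF continuous_R R_lower_bound R_le_2])
  fix a b assume ab: "\<rho> \<le> a" "a < b"
  \<comment> \<open>\<open>\<rho>\<close> plays two roles: it bounds \<open>R\<close> from below and
    it is the parameter \<open>d\<close> of the analytic argument, so every level to be tested lies
    in the range covered there.\<close>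
  have "\<bar>\<omega> i / \<kappa>\<bar> \<le> \<rho>" if "i < N" for i
    using abs_omega_le[OF that] W_less kappa_pos by (simp add: pos_divide_le_eq mult.commute)
  then obtain r where r: "a < r" "r < b"
    "(1 / real N) * (\<Sum>i<N. 1 + cos_sign i * sqrt (1 - (\<omega> i / \<kappa> / r)\<^sup>2)) \<noteq> r"
    using order_parameter_equation_fails[of \<rho> N "\<lambda>i. \<omega> i / \<kappa>" a b cos_sign] rho_pos ab by auto
  moreover have "r > 0" using r(1) ab rho_pos by linarith
  ultimately show "\<exists>r>a. r < b \<and> (\<forall>\<^sub>F t in at_top. R t \<noteq> r)" using R_avoids by blast
qed auto

section \<open>Limits of the phases\<close>

lemma R_limit_ge: "(R \<longlongrightarrow> Rinf) at_top \<Longrightarrow> \<rho> \<le> Rinf"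
  by (rule tendsto_lowerbound) (auto intro: eventually_at_top_linorderI[of 0] R_lower_bound)

lemma sin_theta_limit:
  assumes "i < N" and lim: "(R \<longlongrightarrow> Rinf) at_top"
  shows "((\<lambda>t. sin (\<theta> t i)) \<longlongrightarrow> \<omega> i / (\<kappa> * Rinf)) at_top"
proof -
  have "Rinf \<noteq> 0" using R_limit_ge[OF lim] rho_pos by auto
  then have "((\<lambda>t. (\<omega> i - v i t) / (\<kappa> * R t)) \<longlongrightarrow> (\<omega> i - 0) / (\<kappa> * Rinf)) at_top"
    using kappa_pos by (intro tendsto_intros v_tendsto_0 lim assms) auto
  moreover have "\<forall>\<^sub>F t in at_top. (\<omega> i - v i t) / (\<kappa> * R t) = sin (\<theta> t i)"
    using eventually_ge_at_top[of 0]
  proof eventually_elim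
    case (elim t)
    then have "R t > 0" using R_lower_bound[of t] rho_pos by linarith
    then show ?case using kappa_pos by (simp add: v_eq)
  qed
  ultimately show ?thesis using Lim_transform_eventually by fastforce
qed

text \<open>The bound by \<open>S\<close>, rather than by 1, places the limiting phase strictly
  outside the closed strip. This supplies the strict inequality for the supremum in the
  dichotomy.\<close>

lemma abs_sin_limit_less:
  assumes "i < N" and lim: "(R \<longlongrightarrow> Rinf) at_top"
  shows "\<bar>\<omega> i / (\<kappa> * Rinf)\<bar> < S"
proof -
  have pos: "Rinf > 0" using R_limit_ge[OF lim] rho_pos by linarith
  have "\<bar>\<omega> i\<bar> < \<kappa> * \<rho> * S" using abs_omega_le[OF assms(1)] gap by linarith
  also have "\<dots> \<le> \<kappa> * Rinf * S" using R_limit_ge[OF lim] kappa_pos S_pos by simp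
  finally show ?thesis using pos kappa_pos by (simp add: pos_divide_less_eq mult.commute abs_mult)
qed

lemma theta_limit:
  assumes "i < N" and lim: "(R \<longlongrightarrow> Rinf) at_top"
  shows "\<exists>k::int. ((\<lambda>t. \<theta> t i) \<longlongrightarrow>
    (if eventually_up i then arcsin (\<omega> i / (\<kappa> * Rinf)) else pi - arcsin (\<omega> i / (\<kappa> * Rinf)))
      + 2 * pi * of_int k) at_top"
proof -
  obtain T where T: "T \<ge> 0" "\<And>t. t \<ge> T \<Longrightarrow> cos_sign i * cos (\<theta> t i) > 0"
    using cos_sign_times_cos_pos[OF assms(1)] by blast
  have cont: "continuous_on {T..} (\<lambda>t. \<theta> t i)" using continuous_theta assms T by auto
  have s: "\<bar>\<omega> i / (\<kappa> * Rinf)\<bar> < 1" using abs_sin_limit_less[OF assms] S_le_1 by linarith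
  show ?thesis
  proof (cases "eventually_up i")
    case True
    then obtain k :: int where "\<And>t. t \<ge> T \<Longrightarrow> \<bar>\<theta> t i - 2 * pi * of_int k\<bar> < pi / 2"
      using cos_pos_imp_near_multiple[OF cont] T(2) by (auto simp: cos_sign_def)
    then show ?thesis
      using tendsto_arcsin_of_sin[OF sin_theta_limit[OF assms] s] True by auto
  next
    case False
    \<comment> \<open>The reflection \<theta> -> pi - \<theta> keeps sin and reverses cos, reducing
      this case to the previous one; undoing it turns \<open>k\<close> into
      \<open>- k\<close>.\<close>
    have "continuous_on {T..} (\<lambda>t. pi - \<theta> t i)" by (intro continuous_intros cont)
    then obtain k :: int where k: "\<And>t. t \<ge> T \<Longrightarrow> \<bar>(pi - \<theta> t i) - 2 * pi * of_int k\<bar> < pi / 2"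
      using cos_pos_imp_near_multiple[of T "\<lambda>t. pi - \<theta> t i"] T(2) False by (auto simp: cos_sign_def)
    have "((\<lambda>t. sin (pi - \<theta> t i)) \<longlongrightarrow> \<omega> i / (\<kappa> * Rinf)) at_top"
      using sin_theta_limit[OF assms] by simp
    then have "((\<lambda>t. pi - \<theta> t i) \<longlongrightarrow> arcsin (\<omega> i / (\<kappa> * Rinf)) + 2 * pi * of_int k) at_top"
      by (rule tendsto_arcsin_of_sin[OF _ s k])
    then have "((\<lambda>t. pi - (pi - \<theta> t i)) \<longlongrightarrow> pi - (arcsin (\<omega> i / (\<kappa> * Rinf)) + 2 * pi * of_int k)) at_top"
      by (intro tendsto_intros)
    then show ?thesis using False by (intro exI[of _ "- k"]) (simp add: algebra_simps)
  qed
qed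

text \<open>Staying below the threshold at each time does not exclude a supremum equal to it. The
  limit of cos settles this: it is - sqrt (1 - s^2), and |s| < \<open>S\<close> amounts to sqrt (1 -
  s^2) > 1 - \<mu>.\<close>

lemma SUP_cos_less_iff:
  assumes "i < N"
  shows "(SUP t\<in>{0..}. cos (\<theta> t i)) < -1 + \<mu> \<longleftrightarrow> \<not> eventually_up i"
proof
  assume less: "(SUP t\<in>{0..}. cos (\<theta> t i)) < -1 + \<mu>"
  have "cos (\<theta> t i) \<le> (SUP t\<in>{0..}. cos (\<theta> t i))" if "t \<ge> 0" for t
    by (rule cSUP_upper) (use that in \<open>auto intro!: bdd_aboveI[of _ 1]\<close>)
  then show "\<not> eventually_up i" using less by (force simp: eventually_up_def)
next
  assume down: "\<not> eventually_up i"
  obtain Rinf where Rinf: "(R \<longlongrightarrow> Rinf) at_top" using R_convergent by blast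
  let ?s = "\<omega> i / (\<kappa> * Rinf)"
  have s: "\<bar>?s\<bar> < S" by (rule abs_sin_limit_less[OF assms Rinf])
  show "(SUP t\<in>{0..}. cos (\<theta> t i)) < -1 + \<mu>"
  proof (rule SUP_less_if_limit_less)
    show "continuous_on {0..} (\<lambda>t. cos (\<theta> t i))"
      by (intro continuous_intros continuous_theta assms) auto
    have "((\<lambda>t. cos_sign i * sqrt (1 - (sin (\<theta> t i))\<^sup>2)) \<longlongrightarrow> cos_sign i * sqrt (1 - ?s\<^sup>2)) at_top"
      by (intro tendsto_intros sin_theta_limit assms Rinf)
    then show "((\<lambda>t. cos (\<theta> t i)) \<longlongrightarrow> cos_sign i * sqrt (1 - ?s\<^sup>2)) at_top"
      by (rule Lim_transform_eventually) (use eventually_cos_eq[OF assms] in \<open>auto elim: eventually_mono\<close>)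
    have "?s\<^sup>2 < S\<^sup>2" using s by (metis abs_ge_zero power2_abs power_strict_mono zero_less_numeral)
    then have "(1 - \<mu>)\<^sup>2 < 1 - ?s\<^sup>2" unfolding S_sq by (simp add: power2_eq_square algebra_simps)
    then have "1 - \<mu> < sqrt (1 - ?s\<^sup>2)" by (rule real_less_rsqrt)
    then show "cos_sign i * sqrt (1 - ?s\<^sup>2) < -1 + \<mu>" using down by (simp add: cos_sign_def)
    show "cos (\<theta> t i) < -1 + \<mu>" if "t \<ge> 0" for t
      using down that by (force simp: eventually_up_def)
  qed
qed

section \<open>Differences of two phases that have left the strip\<close>

lemma phase_difference:
  assumes "i < N" "j < N" "T \<ge> 0"
    and up: "\<And>t. t \<ge> T \<Longrightarrow> 1 - \<mu> \<le> cos (\<theta> t i)" "\<And>t. t \<ge> T \<Longrightarrow> 1 - \<mu> \<le> cos (\<theta> t j)"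
  shows "\<exists>(k::int) D. (\<forall>t. D t = \<theta> t i - \<theta> t j + 2 * pi * of_int k)
    \<and> (\<forall>t\<ge>T. \<bar>D t\<bar> < pi)
    \<and> (\<forall>t a b. T \<le> a \<longrightarrow> a \<le> t \<longrightarrow> (D has_real_derivative v i t - v j t) (at t within {a..b}))
    \<and> (\<forall>t\<ge>T. D t \<ge> 0 \<longrightarrow> v i t - v j t \<le> (\<omega> i - \<omega> j) - lam * D t)
    \<and> (\<forall>t\<ge>T. D t \<ge> 0 \<longrightarrow> (\<omega> i - \<omega> j) - 2 * \<kappa> * D t \<le> v i t - v j t)
    \<and> (\<forall>t\<ge>T. D t \<le> 0 \<longrightarrow> (\<omega> i - \<omega> j) - lam * D t \<le> v i t - v j t)"
proof -
  have near: "\<exists>k::int. \<forall>t\<ge>T. \<bar>\<theta> t l - 2 * pi * of_int k\<bar> < pi / 2"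
    if "l < N" "\<And>t. t \<ge> T \<Longrightarrow> 1 - \<mu> \<le> cos (\<theta> t l)" for l
  proof (rule cos_pos_imp_near_multiple)
    show "continuous_on {T..} (\<lambda>t. \<theta> t l)" using continuous_theta that(1) \<open>T \<ge> 0\<close> by auto
    show "cos (\<theta> t l) > 0" if "t \<ge> T" for t
      using \<open>\<And>t. t \<ge> T \<Longrightarrow> 1 - \<mu> \<le> cos (\<theta> t l)\<close>[OF that] mu_less_1 by linarith
  qed
  obtain ki :: int where ki: "\<And>t. t \<ge> T \<Longrightarrow> \<bar>\<theta> t i - 2 * pi * of_int ki\<bar> < pi / 2"
    using near[OF \<open>i < N\<close> up(1)] by auto
  obtain kj :: int where kj: "\<And>t. t \<ge> T \<Longrightarrow> \<bar>\<theta> t j - 2 * pi * of_int kj\<bar> < pi / 2"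
    using near[OF \<open>j < N\<close> up(2)] by auto
  \<comment> \<open>Both phases are translated to the central branch (-pi/2, pi/2). There sin is
    increasing, so the coupling term in \<open>v_diff\<close> has the sign of \<open>D\<close>, and
    the difference is less than pi in size.\<close>
  define x y where "x t = \<theta> t i - 2 * pi * of_int ki" and "y t = \<theta> t j - 2 * pi * of_int kj" for t
  define D where "D t = x t - y t" for t
  have trig: "sin (x t) = sin (\<theta> t i)" "cos (x t) = cos (\<theta> t i)"
    "sin (y t) = sin (\<theta> t j)" "cos (y t) = cos (\<theta> t j)" for t
    by (simp_all add: x_def y_def sin_diff cos_diff)
  have v_diff: "v i t - v j t = (\<omega> i - \<omega> j) - \<kappa> * R t * (sin (x t) - sin (y t))" for t
    by (simp add: v_eq trig algebra_simps)
  have bounds: "\<bar>x t\<bar> < pi / 2" "\<bar>y t\<bar> < pi / 2" "1 - \<mu> \<le> cos (x t)" "1 - \<mu> \<le> cos (y t)" if "t \<ge> T" for t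
    using ki[OF that] kj[OF that] up[OF that] by (simp_all only: trig) (simp_all only: x_def y_def)
  show ?thesis
  proof (intro exI[of _ "kj - ki"] exI[of _ D] conjI allI impI)
    show "D t = \<theta> t i - \<theta> t j + 2 * pi * of_int (kj - ki)" for t
      by (simp add: D_def x_def y_def algebra_simps)
    show "\<bar>D t\<bar> < pi" if "t \<ge> T" for t
      using bounds(1,2)[OF that] by (simp add: D_def)
    show "(D has_real_derivative v i t - v j t) (at t within {a..b})" if "T \<le> a" "a \<le> t" for t a b
      unfolding D_def x_def y_def
      by (auto intro!: derivative_eq_intros theta_deriv) (use that assms in auto)
    show "v i t - v j t \<le> (\<omega> i - \<omega> j) - lam * D t" if t: "t \<ge> T" "D t \<ge> 0" for t
    proof -
      have "(1 - \<mu>) * D t \<le> sin (x t) - sin (y t)"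
        using sin_diff_bounds(1)[of "y t" "x t" "1 - \<mu>"] bounds[OF t(1)] t(2) by (simp add: D_def)
      \<comment> \<open>The rate \<open>lam\<close> combines the least value of \<open>R\<close>
        with the least slope of sin.\<close>
      then have "\<kappa> * \<rho> * ((1 - \<mu>) * D t) \<le> \<kappa> * R t * (sin (x t) - sin (y t))"
        using R_lower_bound[of t] kappa_pos rho_pos mu_less_1 t \<open>T \<ge> 0\<close> by (intro mult_mono) auto
      then show ?thesis unfolding v_diff by (simp add: mult.assoc)
    qed
    show "(\<omega> i - \<omega> j) - 2 * \<kappa> * D t \<le> v i t - v j t" if t: "t \<ge> T" "D t \<ge> 0" for t
    proof -
      have "0 \<le> (1 - \<mu>) * D t" using t mu_less_1 by simp
      then have "0 \<le> sin (x t) - sin (y t)" "sin (x t) - sin (y t) \<le> D t"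
        using sin_diff_bounds[of "y t" "x t" "1 - \<mu>"] bounds[OF t(1)] t(2) by (auto simp: D_def)
      \<comment> \<open>The rate \<open>2 * \<kappa>\<close> combines \<open>R t \<le> 2\<close>
        with slope at most 1.\<close>
      then have "\<kappa> * R t * (sin (x t) - sin (y t)) \<le> \<kappa> * 2 * D t"
        using R_le_2 R_nonneg kappa_pos by (intro mult_mono) auto
      then show ?thesis unfolding v_diff by simp
    qed
    show "(\<omega> i - \<omega> j) - lam * D t \<le> v i t - v j t" if t: "t \<ge> T" "D t \<le> 0" for t
    proof -
      have "(1 - \<mu>) * - D t \<le> sin (y t) - sin (x t)"
        using sin_diff_bounds(1)[of "x t" "y t" "1 - \<mu>"] bounds[OF t(1)] t(2) by (simp add: D_def)
      then have "\<kappa> * \<rho> * ((1 - \<mu>) * - D t) \<le> \<kappa> * R t * (sin (y t) - sin (x t))"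
        using R_lower_bound[of t] kappa_pos rho_pos mu_less_1 t \<open>T \<ge> 0\<close>
        by (intro mult_mono mult_nonneg_nonneg) auto
      then show ?thesis unfolding v_diff by (simp add: algebra_simps)
    qed
  qed
qed

text \<open>At time \<open>t0 + \<tau>\<close> the translated difference may be as low as -pi. It
  then grows at rate at least \<omega>_i - \<omega>_j until it is nonnegative, which explains the
  extra waiting time pi / (\<omega>_i - \<omega>_j) before the lower comparison can start.\<close>

lemma phase_difference_bounds:
  assumes "i < N" "j < N" "t0 \<ge> 0" "-1 + \<mu> \<le> cos (\<theta> t0 i)" "-1 + \<mu> \<le> cos (\<theta> t0 j)"
    and less: "\<omega> j < \<omega> i"
  shows "\<exists>k::int.
      (\<forall>t\<ge>t0 + \<tau>. \<theta> t i - \<theta> t j + 2 * pi * of_int k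
          \<le> (\<omega> i - \<omega> j) / lam + pi * exp (- lam * (t - t0 - \<tau>)))
    \<and> (\<forall>t\<ge>t0 + \<tau> + pi / (\<omega> i - \<omega> j). \<theta> t i - \<theta> t j + 2 * pi * of_int k
          \<ge> (\<omega> i - \<omega> j) / (2 * \<kappa>) - (\<omega> i - \<omega> j) / (2 * \<kappa>)
             * exp (- 2 * \<kappa> * (t - t0 - \<tau> - pi / (\<omega> i - \<omega> j))))"
proof -
  let ?T = "t0 + \<tau>" let ?\<Delta> = "\<omega> i - \<omega> j"
  have T: "?T \<ge> 0" using assms turning_time_pos by linarith
  have up: "1 - \<mu> \<le> cos (\<theta> t i)" "1 - \<mu> \<le> cos (\<theta> t j)" if "t \<ge> ?T" for t
    using cos_eventually_large[OF _ assms(3) that] assms by auto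
  obtain k :: int and D where D: "\<forall>t. D t = \<theta> t i - \<theta> t j + 2 * pi * of_int k"
    and lt_pi: "\<forall>t\<ge>?T. \<bar>D t\<bar> < pi"
    and der: "\<forall>t a b. ?T \<le> a \<longrightarrow> a \<le> t \<longrightarrow> (D has_real_derivative v i t - v j t) (at t within {a..b})"
    and le: "\<forall>t\<ge>?T. D t \<ge> 0 \<longrightarrow> v i t - v j t \<le> ?\<Delta> - lam * D t"
    and ge: "\<forall>t\<ge>?T. D t \<ge> 0 \<longrightarrow> ?\<Delta> - 2 * \<kappa> * D t \<le> v i t - v j t"
    and ge': "\<forall>t\<ge>?T. D t \<le> 0 \<longrightarrow> ?\<Delta> - lam * D t \<le> v i t - v j t"
    using phase_difference[OF assms(1,2) T up] by blast
  note lt_pi = lt_pi[rule_format] and der = der[rule_format] and le = le[rule_format] and ge = ge[rule_format]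
  have "D t \<le> ?\<Delta> / lam + pi * exp (- lam * (t - ?T))" if "t \<ge> ?T" for t
    by (rule linear_comparison_upper[OF that lam_pos _ _ _ der le])
      (use less lt_pi[of ?T] in auto)
  moreover have "?\<Delta> / (2 * \<kappa>) - ?\<Delta> / (2 * \<kappa>) * exp (- (2 * \<kappa>) * (t - (?T + pi / ?\<Delta>))) \<le> D t"
    if t: "t \<ge> ?T + pi / ?\<Delta>" for t
  proof -
    have "pi / ?\<Delta> \<ge> 0" using less by simp
    have nonneg: "D s \<ge> 0" if "s \<ge> ?T + pi / ?\<Delta>" for s
    proof (rule nonneg_after_growth[OF _ _ _ that der])
      show "?\<Delta> \<le> v i x - v j x" if x: "?T \<le> x" "D x \<le> 0" for x
      proof -
        have "lam * D x \<le> 0" using lam_pos x(2) by (intro mult_nonneg_nonpos) auto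
        then show ?thesis using ge'[rule_format, OF x] by linarith
      qed
    qed (use less lt_pi[of ?T] in auto)
    show ?thesis
      by (rule linear_comparison_lower[OF t _ nonneg der ge])
        (use kappa_pos nonneg \<open>pi / ?\<Delta> \<ge> 0\<close> in auto)
  qed
  ultimately show ?thesis
    by (intro exI[of _ k]) (auto simp: D diff_diff_eq)
qed

text \<open>With equal frequencies the upper comparison has zero forcing and applies to both
  \<open>D\<close> and \<open>- D\<close>.\<close>

lemma phase_difference_decay:
  assumes "i < N" "j < N" "t0 \<ge> 0" "-1 + \<mu> \<le> cos (\<theta> t0 i)" "-1 + \<mu> \<le> cos (\<theta> t0 j)"
    and eq: "\<omega> i = \<omega> j"
  shows "\<exists>k::int. \<forall>t\<ge>t0 + \<tau>.
    \<bar>\<theta> t i - \<theta> t j + 2 * pi * of_int k\<bar> \<le> pi * exp (- lam * (t - t0 - \<tau>))"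
proof -
  let ?T = "t0 + \<tau>"
  have T: "?T \<ge> 0" using assms turning_time_pos by linarith
  have up: "1 - \<mu> \<le> cos (\<theta> t i)" "1 - \<mu> \<le> cos (\<theta> t j)" if "t \<ge> ?T" for t
    using cos_eventually_large[OF _ assms(3) that] assms by auto
  obtain k :: int and D where D: "\<forall>t. D t = \<theta> t i - \<theta> t j + 2 * pi * of_int k"
    and lt_pi: "\<forall>t\<ge>?T. \<bar>D t\<bar> < pi"
    and der: "\<forall>t a b. ?T \<le> a \<longrightarrow> a \<le> t \<longrightarrow> (D has_real_derivative v i t - v j t) (at t within {a..b})"
    and le: "\<forall>t\<ge>?T. D t \<ge> 0 \<longrightarrow> v i t - v j t \<le> (\<omega> i - \<omega> j) - lam * D t"
    and ge: "\<forall>t\<ge>?T. D t \<le> 0 \<longrightarrow> (\<omega> i - \<omega> j) - lam * D t \<le> v i t - v j t"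
    using phase_difference[OF assms(1,2) T up] by blast
  note lt_pi = lt_pi[rule_format] and der = der[rule_format] and le = le[rule_format] and ge = ge[rule_format]
  have "\<bar>D t\<bar> \<le> pi * exp (- lam * (t - ?T))" if t: "t \<ge> ?T" for t
  proof -
    have "D t \<le> 0 / lam + pi * exp (- lam * (t - ?T))"
      by (rule linear_comparison_upper[OF t lam_pos _ _ _ der])
        (use le eq lt_pi[of ?T] in auto)
    moreover have "- D t \<le> 0 / lam + pi * exp (- lam * (t - ?T))"
      by (rule linear_comparison_upper[OF t lam_pos _ _ _ DERIV_minus[OF der]])
        (use ge eq lt_pi[of ?T] in force)+
    ultimately show ?thesis by simp
  qed
  then show ?thesis by (intro exI[of _ k]) (auto simp: D diff_diff_eq)
qed

lemma theta_oscillation: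
  assumes "i < N"
  shows "(\<exists>L. ((\<lambda>t. \<theta> t i) \<longlongrightarrow> L) at_top)
    \<and> bdd_above ((\<lambda>t. \<theta> t i) ` {0..}) \<and> bdd_below ((\<lambda>t. \<theta> t i) ` {0..})
    \<and> (SUP t\<in>{0..}. \<theta> t i) - (INF t\<in>{0..}. \<theta> t i) < 2 * pi"
proof -
  obtain L where L: "((\<lambda>t. \<theta> t i) \<longlongrightarrow> L) at_top"
    using R_convergent theta_limit[OF assms] by blast
  have persist: "-1 + \<mu> \<le> cos (\<theta> w i)" if "0 \<le> u" "u \<le> w" "-1 + \<mu> \<le> cos (\<theta> u i)" for u w
    by (rule cos_persists[OF \<open>i < N\<close> that(1,2) _ that(3)]) (use mu_less_1 in simp)
  have c: "-1 < -1 + \<mu>" "-1 + \<mu> \<le> 1" using mu mu_less_1 by auto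
  show ?thesis
    using oscillation_less_2pi[OF continuous_theta[OF assms] L c persist] L by auto
qed

end

theorem theorem2p1:
  fixes N :: nat and \<omega> :: "nat \<Rightarrow> real" and \<kappa> \<mu> :: real
    and \<theta> :: "real \<Rightarrow> nat \<Rightarrow> real"
  assumes N: "N \<ge> 1"
    and ode: "\<forall>i<N. \<forall>t\<ge>0. ((\<lambda>s. \<theta> s i) has_real_derivative vel N \<omega> \<kappa> \<theta> i t) (at t within {0..})"
    and R0pos: "orderR N \<theta> 0 > 0"
    and mu: "0 < \<mu>" "\<mu> < min (orderR N \<theta> 0) 1"
    and kappa: "\<kappa> > normInf N \<omega> / ((orderR N \<theta> 0 - \<mu>) * sqrt (\<mu> * (2 - \<mu>)))"
  defines "\<tau> \<equiv> pi / (\<kappa> * (orderR N \<theta> 0 - \<mu>) * sqrt (\<mu> * (2 - \<mu>)) - normInf N \<omega>)"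
    and "lam \<equiv> \<kappa> * (orderR N \<theta> 0 - \<mu>) * (1 - \<mu>)"
  shows
    \<comment> \<open>(a)\<close>
    "(\<forall>t\<ge>0. orderR N \<theta> t \<ge> orderR N \<theta> 0 - \<mu>)
    \<comment> \<open>(b)\<close>
   \<and> (\<forall>i<N. (\<exists>L. ((\<lambda>t. \<theta> t i) \<longlongrightarrow> L) at_top)
        \<and> bdd_above ((\<lambda>t. \<theta> t i) ` {0..}) \<and> bdd_below ((\<lambda>t. \<theta> t i) ` {0..})
        \<and> (SUP t\<in>{0..}. \<theta> t i) - (INF t\<in>{0..}. \<theta> t i) < 2 * pi
        \<and> ((\<lambda>t. vel N \<omega> \<kappa> \<theta> i t) \<longlongrightarrow> 0) at_top)
    \<comment> \<open>(c)\<close>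
   \<and> (\<forall>i<N. \<forall>t0\<ge>0. cos (\<theta> t0 i) \<ge> -1 + \<mu> \<longrightarrow>
        (\<forall>t\<ge>t0. cos (\<theta> t i) \<ge> -1 + \<mu>) \<and> (\<forall>t\<ge>t0 + \<tau>. cos (\<theta> t i) \<ge> 1 - \<mu>))
    \<comment> \<open>(d)\<close>
   \<and> (\<exists>Rinf. ((\<lambda>t. orderR N \<theta> t) \<longlongrightarrow> Rinf) at_top)
   \<and> (\<forall>i<N. \<forall>L Rinf. ((\<lambda>t. \<theta> t i) \<longlongrightarrow> L) at_top \<longrightarrow> ((\<lambda>t. orderR N \<theta> t) \<longlongrightarrow> Rinf) at_top \<longrightarrow>
        ((SUP t\<in>{0..}. cos (\<theta> t i)) < -1 + \<mu> \<longrightarrow>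
            (\<exists>k::int. L = pi - arcsin (\<omega> i / (\<kappa> * Rinf)) + 2 * pi * of_int k))
      \<and> ((SUP t\<in>{0..}. cos (\<theta> t i)) \<ge> -1 + \<mu> \<longrightarrow>
            (\<exists>k::int. L = arcsin (\<omega> i / (\<kappa> * Rinf)) + 2 * pi * of_int k)))
    \<comment> \<open>(e)\<close>
   \<and> (\<forall>i<N. \<forall>j<N. \<forall>t0\<ge>0. cos (\<theta> t0 i) \<ge> -1 + \<mu> \<and> cos (\<theta> t0 j) \<ge> -1 + \<mu> \<longrightarrow>
        (\<omega> i > \<omega> j \<longrightarrow> (\<exists>k::int.
            (\<forall>t\<ge>t0 + \<tau>. \<theta> t i - \<theta> t j + 2 * pi * of_int k
                \<le> (\<omega> i - \<omega> j) / lam + pi * exp (- lam * (t - t0 - \<tau>)))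
          \<and> (\<forall>t\<ge>t0 + \<tau> + pi / (\<omega> i - \<omega> j). \<theta> t i - \<theta> t j + 2 * pi * of_int k
                \<ge> (\<omega> i - \<omega> j) / (2 * \<kappa>) - (\<omega> i - \<omega> j) / (2 * \<kappa>)
                   * exp (- 2 * \<kappa> * (t - t0 - \<tau> - pi / (\<omega> i - \<omega> j))))))
      \<and> (\<omega> i = \<omega> j \<longrightarrow> (\<exists>k::int.
            \<forall>t\<ge>t0 + \<tau>. \<bar>\<theta> t i - \<theta> t j + 2 * pi * of_int k\<bar> \<le> pi * exp (- lam * (t - t0 - \<tau>)))))"
proof -
  interpret winfree N \<omega> \<kappa> \<mu> \<theta>
    by unfold_locales (use assms in auto)
  have \<tau>: "\<tau> = pi / (\<kappa> * (orderR N \<theta> 0 - \<mu>) * S - normInf N \<omega>)"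
    by (simp add: \<tau>_def S_def)
  \<comment> \<open>The statement concerns arbitrary limits \<open>L\<close> and
    \<open>Rinf\<close>; uniqueness of limits identifies \<open>L\<close> with the computed
    one.\<close>
  have d: "\<exists>k::int. L = (if eventually_up i then arcsin (\<omega> i / (\<kappa> * Rinf))
      else pi - arcsin (\<omega> i / (\<kappa> * Rinf))) + 2 * pi * of_int k"
    if "i < N" "((\<lambda>t. \<theta> t i) \<longlongrightarrow> L) at_top" "(orderR N \<theta> \<longlongrightarrow> Rinf) at_top" for i L Rinf
    using theta_limit[OF that(1,3)] tendsto_unique[OF _ that(2)] by (meson trivial_limit_at_top_linorder)
  show ?thesis
  proof (intro conjI allI impI; (elim conjE)?)
    show "\<exists>L. ((\<lambda>t. \<theta> t i) \<longlongrightarrow> L) at_top" "bdd_above ((\<lambda>t. \<theta> t i) ` {0..})"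
      "bdd_below ((\<lambda>t. \<theta> t i) ` {0..})" "(SUP t\<in>{0..}. \<theta> t i) - (INF t\<in>{0..}. \<theta> t i) < 2 * pi"
      if "i < N" for i
      using theta_oscillation[OF that] by auto
  next
    fix i t0 t assume "i < N" "0 \<le> t0" "-1 + \<mu> \<le> cos (\<theta> t0 i)" "t0 \<le> t"
    then show "-1 + \<mu> \<le> cos (\<theta> t i)" using cos_persists[of i t0 t "-1 + \<mu>"] mu_less_1 by simp
  next
    fix i t0 t assume "i < N" "0 \<le> t0" "-1 + \<mu> \<le> cos (\<theta> t0 i)" "t0 + \<tau> \<le> t"
    then show "1 - \<mu> \<le> cos (\<theta> t i)" using cos_eventually_large unfolding \<tau> by blast
  next
    fix i L Rinf
    assume "i < N" "((\<lambda>t. \<theta> t i) \<longlongrightarrow> L) at_top" "((\<lambda>t. orderR N \<theta> t) \<longlongrightarrow> Rinf) at_top"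
      "(SUP t\<in>{0..}. cos (\<theta> t i)) < -1 + \<mu>"
    then show "\<exists>k::int. L = pi - arcsin (\<omega> i / (\<kappa> * Rinf)) + 2 * pi * of_int k"
      using d[of i L Rinf] SUP_cos_less_iff[of i] by auto
  next
    fix i L Rinf
    assume "i < N" "((\<lambda>t. \<theta> t i) \<longlongrightarrow> L) at_top" "((\<lambda>t. orderR N \<theta> t) \<longlongrightarrow> Rinf) at_top"
      "-1 + \<mu> \<le> (SUP t\<in>{0..}. cos (\<theta> t i))"
    then show "\<exists>k::int. L = arcsin (\<omega> i / (\<kappa> * Rinf)) + 2 * pi * of_int k"
      using d[of i L Rinf] SUP_cos_less_iff[of i] by (auto simp: not_le[symmetric])
  qed (use R_lower_bound v_tendsto_0 R_convergent phase_difference_bounds phase_difference_decay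
      in \<open>auto simp: \<tau> lam_def\<close>)
qed

end
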